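(* Let $(M^n,g)$ be a Riemannian manifold carrying a conformal product structure with Lee form $\theta$ and orthogonal $D$-parallel splitting $TM=T_1\oplus T_2$, $p=\operatorname{rank}T_1\ge2$, $q=\operatorname{rank}T_2\ge2$, $n=p+q$. For $X\in T_1$ and $U\in T_2$ one has, without any Ricci assumption, $$(\nabla_X\theta)(U)=\theta_1(X)\theta_2(U)+\frac{q-1}{n-2}\,d\theta(X,U)+\frac1{n-2}\operatorname{Ric}(X,U),$$ $$(\nabla_U\theta)(X)=\theta_1(X)\theta_2(U)-\frac{p-1}{n-2}\,d\theta(X,U)+\frac1{n-2}\operatorname{Ric}(X,U).$$ If $\operatorname{Ric}(T_1,T_2)=0$, these reduce to $$(\nabla_X\theta)(U)=\theta_1(X)\theta_2(U)+\frac{q-1}{n-2}\,d\theta(X,U),\qquad (\nabla_U\theta)(X)=\theta_1(X)\theta_2(U)-\frac{p-1}{n-2}\,d\theta(X,U).$$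
   Context: Let $\nabla$ be the Levi-Civita connection of $g$. A Weyl connection on $(M,g)$ is a connection of the form $D_XY=\nabla_XY+\theta(Y)X+\theta(X)Y-g(X,Y)\theta^\sharp$ for a one-form $\theta$, called its Lee form. A conformal product structure on $(M,g)$ is a $g$-orthogonal splitting $TM=T_1\oplus T_2$ into distributions of constant rank together with a Weyl connection $D$ (the adapted Weyl connection) preserving both $T_1$ and $T_2$. Write $\theta=\theta_1+\theta_2$ with $\theta_i\in T_i^*$ (i.e. $\theta_1$ vanishes on $T_2$ and $\theta_2$ vanishes on $T_1$). $\operatorname{Ric}(X,Y)=\sum_i g(R(X,e_i)e_i,Y)$ with $R(X,Y)Z=\nabla_X\nabla_YZ-\nabla_Y\nabla_XZ-\nabla_{[X,Y]}Z$. $d\theta(X,Y)=X\theta(Y)-Y\theta(X)-\theta([X,Y])$. *)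

theory Defs
  imports "HOL-Analysis.Analysis"
begin

section \<open>Smooth maps between Euclidean spaces\<close>

text \<open>Only used for open \<open>S\<close>, where the derivative at a point of \<open>S\<close> is unambiguous.\<close>

primrec Ck_on :: "nat \<Rightarrow> 'e::euclidean_space set \<Rightarrow> ('e \<Rightarrow> 'f::real_normed_vector) \<Rightarrow> bool" where
  "Ck_on 0 S f \<longleftrightarrow> continuous_on S f"
| "Ck_on (Suc k) S f \<longleftrightarrow>
     f differentiable_on S \<and> (\<forall>v. Ck_on k S (\<lambda>x. frechet_derivative f (at x) v))"

definition smooth_on :: "'e::euclidean_space set \<Rightarrow> ('e \<Rightarrow> 'f::real_normed_vector) \<Rightarrow> bool" where
  "smooth_on S f \<longleftrightarrow> (\<forall>k. Ck_on k S f)"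


section \<open>Smooth manifolds\<close>

text \<open>A chart is a pair of its domain and its coordinate map.  Coordinate maps are total functions;
  only their values on the domain matter.\<close>

type_synonym ('a, 'n) chart = "'a set \<times> ('a \<Rightarrow> real ^ 'n)"

definition chart_inv :: "('a, 'n) chart \<Rightarrow> real ^ 'n \<Rightarrow> 'a" where
  "chart_inv c = inv_into (fst c) (snd c)"

definition is_chart :: "'a topology \<Rightarrow> ('a, 'n::finite) chart \<Rightarrow> bool" where
  "is_chart M c \<longleftrightarrow> openin M (fst c) \<and> open (snd c ` fst c) \<and>
     homeomorphic_map (subtopology M (fst c)) (top_of_set (snd c ` fst c)) (snd c)"

definition smooth_manifold :: "'a topology \<Rightarrow> ('a, 'n::finite) chart set \<Rightarrow> bool" where
  "smooth_manifold M A \<longleftrightarrow>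
     Hausdorff_space M \<and> second_countable M \<and>
     (\<forall>c\<in>A. is_chart M c) \<and>
     (\<Union>c\<in>A. fst c) = topspace M \<and>
     (\<forall>c\<in>A. \<forall>c'\<in>A. smooth_on (snd c ` (fst c \<inter> fst c')) (snd c' \<circ> chart_inv c))"

text \<open>The tangent space at \<open>x\<close> is \<open>real ^ 'n\<close>, a vector being given by its components in one
  preferred chart \<open>chart_at A x\<close> around \<open>x\<close>.  \<open>components A c x v\<close> are the components of the tangent
  vector \<open>v\<close> at \<open>x\<close> in another chart \<open>c\<close> around \<open>x\<close>.  The preferred chart may jump from point to
  point, so smoothness of a vector field \<open>X :: 'a \<Rightarrow> real ^ 'n\<close> is not smoothness of \<open>X\<close> as a map
  into \<open>real ^ 'n\<close>: it is always expressed through \<open>components\<close> in the charts of the atlas.\<close>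

definition chart_at :: "('a, 'n) chart set \<Rightarrow> 'a \<Rightarrow> ('a, 'n) chart" where
  "chart_at A x = (SOME c. c \<in> A \<and> x \<in> fst c)"

definition components ::
  "('a, 'n::finite) chart set \<Rightarrow> ('a, 'n) chart \<Rightarrow> 'a \<Rightarrow> real ^ 'n \<Rightarrow> real ^ 'n" where
  "components A c x v =
     frechet_derivative (snd c \<circ> chart_inv (chart_at A x)) (at (snd (chart_at A x) x)) v"

definition local_rep ::
  "('a, 'n::finite) chart set \<Rightarrow> ('a, 'n) chart \<Rightarrow> ('a \<Rightarrow> real ^ 'n) \<Rightarrow> real ^ 'n \<Rightarrow> real ^ 'n" where
  "local_rep A c X z = components A c (chart_inv c z) (X (chart_inv c z))"

text \<open>Functions and fields are total; smoothness on an open \<open>W\<close> says nothing about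
  the values outside \<open>W\<close>.\<close>

definition smooth_fun :: "('a, 'n::finite) chart set \<Rightarrow> 'a set \<Rightarrow> ('a \<Rightarrow> real) \<Rightarrow> bool" where
  "smooth_fun A W f \<longleftrightarrow> (\<forall>c\<in>A. smooth_on (snd c ` (fst c \<inter> W)) (f \<circ> chart_inv c))"

definition smooth_field :: "('a, 'n::finite) chart set \<Rightarrow> 'a set \<Rightarrow> ('a \<Rightarrow> real ^ 'n) \<Rightarrow> bool" where
  "smooth_field A W X \<longleftrightarrow> (\<forall>c\<in>A. smooth_on (snd c ` (fst c \<inter> W)) (local_rep A c X))"

text \<open>\<open>dir_deriv A X f\<close> is the function \<open>X(f)\<close>.\<close>

definition dir_deriv ::
  "('a, 'n::finite) chart set \<Rightarrow> ('a \<Rightarrow> real ^ 'n) \<Rightarrow> ('a \<Rightarrow> real) \<Rightarrow> 'a \<Rightarrow> real" where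
  "dir_deriv A X f x =
     frechet_derivative (f \<circ> chart_inv (chart_at A x)) (at (snd (chart_at A x) x)) (X x)"

text \<open>\<open>[X, Y]\<^sup>k = X\<^sup>i \<partial>\<^sub>i Y\<^sup>k - Y\<^sup>i \<partial>\<^sub>i X\<^sup>k\<close>, computed at \<open>x\<close> in the preferred chart at \<open>x\<close>.\<close>

definition lie_bracket ::
  "('a, 'n::finite) chart set \<Rightarrow> ('a \<Rightarrow> real ^ 'n) \<Rightarrow> ('a \<Rightarrow> real ^ 'n) \<Rightarrow> 'a \<Rightarrow> real ^ 'n" where
  "lie_bracket A X Y x =
     (let c = chart_at A x in
        frechet_derivative (local_rep A c Y) (at (snd c x)) (X x)
      - frechet_derivative (local_rep A c X) (at (snd c x)) (Y x))"


section \<open>Tensor fields and distributions\<close>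

definition one_form ::
  "'a topology \<Rightarrow> ('a, 'n::finite) chart set \<Rightarrow> ('a \<Rightarrow> real ^ 'n \<Rightarrow> real) \<Rightarrow> bool" where
  "one_form M A \<theta> \<longleftrightarrow>
     (\<forall>x\<in>topspace M. linear (\<theta> x)) \<and>
     (\<forall>W X. openin M W \<and> smooth_field A W X \<longrightarrow> smooth_fun A W (\<lambda>x. \<theta> x (X x)))"

definition riemannian_metric ::
  "'a topology \<Rightarrow> ('a, 'n::finite) chart set \<Rightarrow> ('a \<Rightarrow> real ^ 'n \<Rightarrow> real ^ 'n \<Rightarrow> real) \<Rightarrow> bool" where
  "riemannian_metric M A g \<longleftrightarrow>
     (\<forall>x\<in>topspace M. bilinear (g x) \<and> (\<forall>v w. g x v w = g x w v) \<and> (\<forall>v. v \<noteq> 0 \<longrightarrow> g x v v > 0)) \<and>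
     (\<forall>W X Y. openin M W \<and> smooth_field A W X \<and> smooth_field A W Y \<longrightarrow>
        smooth_fun A W (\<lambda>x. g x (X x) (Y x)))"

definition section_on ::
  "('a, 'n::finite) chart set \<Rightarrow> ('a \<Rightarrow> (real ^ 'n) set) \<Rightarrow> 'a set \<Rightarrow> ('a \<Rightarrow> real ^ 'n) \<Rightarrow> bool" where
  "section_on A T W X \<longleftrightarrow> smooth_field A W X \<and> (\<forall>x\<in>W. X x \<in> T x)"

definition distribution ::
  "'a topology \<Rightarrow> ('a, 'n::finite) chart set \<Rightarrow> nat \<Rightarrow> ('a \<Rightarrow> (real ^ 'n) set) \<Rightarrow> bool" where
  "distribution M A r T \<longleftrightarrow>
     (\<forall>x\<in>topspace M. subspace (T x) \<and> dim (T x) = r) \<and>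
     (\<forall>x\<in>topspace M. \<exists>W. openin M W \<and> x \<in> W \<and>
        (\<exists>E :: nat \<Rightarrow> 'a \<Rightarrow> real ^ 'n.
           (\<forall>i<r. smooth_field A W (E i)) \<and> (\<forall>y\<in>W. T y = span {E i y | i. i < r})))"

definition exterior_deriv ::
  "('a, 'n::finite) chart set \<Rightarrow> ('a \<Rightarrow> real ^ 'n \<Rightarrow> real) \<Rightarrow>
     ('a \<Rightarrow> real ^ 'n) \<Rightarrow> ('a \<Rightarrow> real ^ 'n) \<Rightarrow> 'a \<Rightarrow> real" where
  "exterior_deriv A \<theta> X Y x =
     dir_deriv A X (\<lambda>y. \<theta> y (Y y)) x - dir_deriv A Y (\<lambda>y. \<theta> y (X y)) x
     - \<theta> x (lie_bracket A X Y x)"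


section \<open>Connections and curvature\<close>

text \<open>A connection acts on fields that are smooth on some open set \<open>W\<close>, and the axioms are required
  on every such \<open>W\<close>.  Locality follows and is not assumed: if \<open>X\<close> vanishes on \<open>W\<close>,
  take \<open>f\<close> to be \<open>0\<close> on \<open>W\<close> and \<open>1\<close> elsewhere; then \<open>f X = X\<close>, so \<open>D X Y\<close> and \<open>D Y X\<close> vanish on \<open>W\<close>
  by \<open>C\<^sup>\<infinity>\<close>-linearity and the Leibniz rule.\<close>

type_synonym ('a, 'n) conn = "('a \<Rightarrow> real ^ 'n) \<Rightarrow> ('a \<Rightarrow> real ^ 'n) \<Rightarrow> 'a \<Rightarrow> real ^ 'n"

definition connection ::
  "'a topology \<Rightarrow> ('a, 'n::finite) chart set \<Rightarrow> ('a, 'n) conn \<Rightarrow> bool" where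
  "connection M A D \<longleftrightarrow>
     (\<forall>W X Y Z f. openin M W \<and> smooth_field A W X \<and> smooth_field A W Y \<and> smooth_field A W Z \<and>
          smooth_fun A W f \<longrightarrow>
        smooth_field A W (D X Y) \<and>
        (\<forall>x\<in>W.
           D (\<lambda>y. X y + Z y) Y x = D X Y x + D Z Y x \<and>
           D (\<lambda>y. f y *\<^sub>R X y) Y x = f x *\<^sub>R D X Y x \<and>
           D X (\<lambda>y. Y y + Z y) x = D X Y x + D X Z x \<and>
           D X (\<lambda>y. f y *\<^sub>R Y y) x = dir_deriv A X f x *\<^sub>R Y x + f x *\<^sub>R D X Y x))"

definition levi_civita ::
  "'a topology \<Rightarrow> ('a, 'n::finite) chart set \<Rightarrow> ('a \<Rightarrow> real ^ 'n \<Rightarrow> real ^ 'n \<Rightarrow> real) \<Rightarrow>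
     ('a, 'n) conn \<Rightarrow> bool" where
  "levi_civita M A g nabla \<longleftrightarrow>
     connection M A nabla \<and>
     (\<forall>W X Y. openin M W \<and> smooth_field A W X \<and> smooth_field A W Y \<longrightarrow>
        (\<forall>x\<in>W. nabla X Y x - nabla Y X x = lie_bracket A X Y x)) \<and>
     (\<forall>W X Y Z. openin M W \<and> smooth_field A W X \<and> smooth_field A W Y \<and> smooth_field A W Z \<longrightarrow>
        (\<forall>x\<in>W. dir_deriv A X (\<lambda>y. g y (Y y) (Z y)) x = g x (nabla X Y x) (Z x) + g x (Y x) (nabla X Z x)))"

text \<open>\<open>cov_deriv_form A nabla \<theta> X Y\<close> is the function \<open>(nabla\<^sub>X \<theta>)(Y)\<close>.\<close>

definition cov_deriv_form ::
  "('a, 'n::finite) chart set \<Rightarrow> ('a, 'n) conn \<Rightarrow> ('a \<Rightarrow> real ^ 'n \<Rightarrow> real) \<Rightarrow>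
     ('a \<Rightarrow> real ^ 'n) \<Rightarrow> ('a \<Rightarrow> real ^ 'n) \<Rightarrow> 'a \<Rightarrow> real" where
  "cov_deriv_form A nabla \<theta> X Y x = dir_deriv A X (\<lambda>y. \<theta> y (Y y)) x - \<theta> x (nabla X Y x)"

definition curvature ::
  "('a, 'n::finite) chart set \<Rightarrow> ('a, 'n) conn \<Rightarrow>
     ('a \<Rightarrow> real ^ 'n) \<Rightarrow> ('a \<Rightarrow> real ^ 'n) \<Rightarrow> ('a \<Rightarrow> real ^ 'n) \<Rightarrow> 'a \<Rightarrow> real ^ 'n" where
  "curvature A nabla X Y Z x = nabla X (nabla Y Z) x - nabla Y (nabla X Z) x - nabla (lie_bracket A X Y) Z x"

text \<open>The value on tangent vectors at \<open>x\<close>: extend them to smooth fields near \<open>x\<close>; by tensoriality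
  the result does not depend on the extensions.\<close>

definition curvature_at ::
  "'a topology \<Rightarrow> ('a, 'n::finite) chart set \<Rightarrow> ('a, 'n) conn \<Rightarrow>
     'a \<Rightarrow> real ^ 'n \<Rightarrow> real ^ 'n \<Rightarrow> real ^ 'n \<Rightarrow> real ^ 'n" where
  "curvature_at M A nabla x u v w =
     (THE r. \<exists>W X Y Z. openin M W \<and> x \<in> W \<and>
        smooth_field A W X \<and> smooth_field A W Y \<and> smooth_field A W Z \<and>
        X x = u \<and> Y x = v \<and> Z x = w \<and> r = curvature A nabla X Y Z x)"

text \<open>Likewise the trace defining \<open>Ric\<close> does not depend on the orthonormal basis \<open>e\<close> of the
  tangent space at \<open>x\<close>.\<close>

definition ricci ::
  "'a topology \<Rightarrow> ('a, 'n::finite) chart set \<Rightarrow> ('a \<Rightarrow> real ^ 'n \<Rightarrow> real ^ 'n \<Rightarrow> real) \<Rightarrow>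
     ('a, 'n) conn \<Rightarrow> 'a \<Rightarrow> real ^ 'n \<Rightarrow> real ^ 'n \<Rightarrow> real" where
  "ricci M A g nabla x u v =
     (THE r. \<exists>e :: 'n \<Rightarrow> real ^ 'n.
        (\<forall>i j. g x (e i) (e j) = (if i = j then 1 else 0)) \<and>
        r = (\<Sum>i\<in>UNIV. g x (curvature_at M A nabla x u (e i) (e i)) v))"


section \<open>Conformal product structures\<close>

definition sharp ::
  "('a \<Rightarrow> real ^ 'n::finite \<Rightarrow> real ^ 'n \<Rightarrow> real) \<Rightarrow> ('a \<Rightarrow> real ^ 'n \<Rightarrow> real) \<Rightarrow> 'a \<Rightarrow> real ^ 'n" where
  "sharp g \<theta> x = (THE v. \<forall>w. g x v w = \<theta> x w)"

definition weyl_connection ::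
  "'a topology \<Rightarrow> ('a, 'n::finite) chart set \<Rightarrow> ('a \<Rightarrow> real ^ 'n \<Rightarrow> real ^ 'n \<Rightarrow> real) \<Rightarrow>
     ('a, 'n) conn \<Rightarrow> ('a \<Rightarrow> real ^ 'n \<Rightarrow> real) \<Rightarrow> ('a, 'n) conn \<Rightarrow> bool" where
  "weyl_connection M A g nabla \<theta> D \<longleftrightarrow>
     one_form M A \<theta> \<and> connection M A D \<and>
     (\<forall>W X Y. openin M W \<and> smooth_field A W X \<and> smooth_field A W Y \<longrightarrow>
        (\<forall>x\<in>W. D X Y x = nabla X Y x + \<theta> x (Y x) *\<^sub>R X x + \<theta> x (X x) *\<^sub>R Y x
                          - g x (X x) (Y x) *\<^sub>R sharp g \<theta> x))"

definition preserves ::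
  "'a topology \<Rightarrow> ('a, 'n::finite) chart set \<Rightarrow> ('a, 'n) conn \<Rightarrow> ('a \<Rightarrow> (real ^ 'n) set) \<Rightarrow> bool" where
  "preserves M A D T \<longleftrightarrow>
     (\<forall>W X Y. openin M W \<and> smooth_field A W X \<and> section_on A T W Y \<longrightarrow> section_on A T W (D X Y))"

text \<open>The tangent space is all of \<open>real ^ 'n\<close>, so the last two conjuncts below say that
  it is the direct sum of \<open>T1 x\<close> and \<open>T2 x\<close>.\<close>

definition orthogonal_splitting ::
  "'a topology \<Rightarrow> ('a, 'n::finite) chart set \<Rightarrow> ('a \<Rightarrow> real ^ 'n \<Rightarrow> real ^ 'n \<Rightarrow> real) \<Rightarrow>
     nat \<Rightarrow> nat \<Rightarrow> ('a \<Rightarrow> (real ^ 'n) set) \<Rightarrow> ('a \<Rightarrow> (real ^ 'n) set) \<Rightarrow> bool" where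
  "orthogonal_splitting M A g p q T1 T2 \<longleftrightarrow>
     distribution M A p T1 \<and> distribution M A q T2 \<and>
     (\<forall>x\<in>topspace M.
        (\<forall>u\<in>T1 x. \<forall>v\<in>T2 x. g x u v = 0) \<and>
        T1 x \<inter> T2 x = {0} \<and>
        (\<forall>w. \<exists>u\<in>T1 x. \<exists>v\<in>T2 x. w = u + v))"

definition conformal_product ::
  "'a topology \<Rightarrow> ('a, 'n::finite) chart set \<Rightarrow> ('a \<Rightarrow> real ^ 'n \<Rightarrow> real ^ 'n \<Rightarrow> real) \<Rightarrow>
     ('a, 'n) conn \<Rightarrow> nat \<Rightarrow> nat \<Rightarrow> ('a \<Rightarrow> (real ^ 'n) set) \<Rightarrow> ('a \<Rightarrow> (real ^ 'n) set) \<Rightarrow>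
     ('a \<Rightarrow> real ^ 'n \<Rightarrow> real) \<Rightarrow> ('a, 'n) conn \<Rightarrow> bool" where
  "conformal_product M A g nabla p q T1 T2 \<theta> D \<longleftrightarrow>
     orthogonal_splitting M A g p q T1 T2 \<and>
     weyl_connection M A g nabla \<theta> D \<and>
     preserves M A D T1 \<and> preserves M A D T2"

text \<open>\<open>\<theta> = \<theta>1 + \<theta>2\<close> where \<open>\<theta>1\<close> vanishes on \<open>T2\<close> and \<open>\<theta>2\<close> vanishes on \<open>T1\<close>.\<close>

definition form_splitting ::
  "'a topology \<Rightarrow> ('a \<Rightarrow> (real ^ 'n::finite) set) \<Rightarrow> ('a \<Rightarrow> (real ^ 'n) set) \<Rightarrow>
     ('a \<Rightarrow> real ^ 'n \<Rightarrow> real) \<Rightarrow> ('a \<Rightarrow> real ^ 'n \<Rightarrow> real) \<Rightarrow> ('a \<Rightarrow> real ^ 'n \<Rightarrow> real) \<Rightarrow> bool" where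
  "form_splitting M T1 T2 \<theta> \<theta>1 \<theta>2 \<longleftrightarrow>
     (\<forall>x\<in>topspace M. linear (\<theta>1 x) \<and> linear (\<theta>2 x) \<and>
        (\<forall>w. \<theta> x w = \<theta>1 x w + \<theta>2 x w) \<and>
        (\<forall>v\<in>T2 x. \<theta>1 x v = 0) \<and> (\<forall>u\<in>T1 x. \<theta>2 x u = 0))"

end

theory Submission
  imports Defs
begin

text \<open>
  Let \<open>X\<close>, \<open>Y\<close>, \<open>E\<close> be sections of \<open>T1\<close> and \<open>U\<close> a section of \<open>T2\<close>.  Because \<open>D\<^sub>X E\<close> stays in \<open>T1\<close>, the
  formula for the Weyl connection gives \<open>g(\<nabla>\<^sub>X E, U) = g(X, E) \<theta>(U)\<close>, and because \<open>D\<^sub>Y U\<close> stays in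
  \<open>T2\<close>, the field \<open>\<nabla>\<^sub>Y U\<close> is a section of \<open>T2\<close> up to a multiple of \<open>Y\<close>.  Differentiating the first identity
  along \<open>Y\<close> and antisymmetrizing, all terms cancel except
  \<open>g(R(Y, X)E, U) = g(X, E) P(Y) - g(Y, E) P(X)\<close>, where \<open>P(Y) = (\<nabla>\<^sub>Y \<theta>)(U) - \<theta>(Y) \<theta>(U)\<close>.  Only
  functions are differentiated here, never the field \<open>\<theta>\<^sup>\<sharp>\<close>.

  Summing \<open>g(R(X, e)e, U)\<close> over an orthonormal basis of \<open>T1\<close> therefore gives \<open>(p - 1) P(X)\<close>.  For \<open>e\<close> in
  \<open>T2\<close> the pair symmetry of the curvature tensor turns \<open>g(R(X, e)e, U)\<close> into \<open>g(R(U, e)e, X)\<close>, which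
  is the same situation with the two distributions exchanged.  Hence
  \<open>Ric(X, U) = (p - 1) a + (q - 1) b\<close> with \<open>a = (\<nabla>\<^sub>X \<theta>)(U) - \<theta>(X) \<theta>(U)\<close> and
  \<open>b = (\<nabla>\<^sub>U \<theta>)(X) - \<theta>(X) \<theta>(U)\<close> (lemma \<open>conformal_product_ricci\<close>).  Since \<open>\<nabla>\<close> is torsion-free,
  \<open>d\<theta>(X, U) = a - b\<close>.  The claimed formulas are the solution of these two linear equations for \<open>a\<close> and
  \<open>b\<close>; up to sign, their determinant is \<open>p + q - 2 = n - 2\<close>.

  The rest of the text justifies the ingredients from the definitions in charts: smooth maps are
  closed under sums, products and composition and have symmetric second derivatives; the
  Lie bracket is the commutator of derivations; the curvature at a point depends only on the values of the
  three fields there and has the usual symmetries; the trace defining \<open>Ric\<close> is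
  independent of the orthonormal basis.
\<close>

section \<open>Calculus of smooth maps\<close>

abbreviation fder ::
  "('e::real_normed_vector \<Rightarrow> 'f::real_normed_vector) \<Rightarrow> 'e \<Rightarrow> 'e \<Rightarrow> 'f" where
  "fder f x \<equiv> frechet_derivative f (at x)"

lemma fder_eq: "(f has_derivative f') (at x) \<Longrightarrow> fder f x = f'"
  by (metis frechet_derivative_at)

lemma fder_works: "f differentiable (at x) \<Longrightarrow> (f has_derivative fder f x) (at x)"
  using frechet_derivative_works by blast

lemma fder_cong:
  assumes "open S" "x \<in> S" "\<And>y. y \<in> S \<Longrightarrow> f y = g y"
  shows "fder f x = fder g x"
proof -
  have "\<And>L. (f has_derivative L) (at x) \<longleftrightarrow> (g has_derivative L) (at x)"
    using assms by (metis has_derivative_transform_within_open)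
  thus ?thesis by (simp add: frechet_derivative_def)
qed

lemma fder_linear: "f differentiable (at x) \<Longrightarrow> linear (fder f x)"
  using fder_works has_derivative_linear by blast

lemma Ck_on_Suc_D: "Ck_on (Suc k) S f \<Longrightarrow> Ck_on k S f"
proof (induction k arbitrary: f)
  case 0
  thus ?case by (simp add: differentiable_imp_continuous_on)
next
  case (Suc k)
  thus ?case by simp
qed

lemma Ck_on_subset: "Ck_on k S f \<Longrightarrow> T \<subseteq> S \<Longrightarrow> Ck_on k T f"
  by (induction k arbitrary: f) (auto intro: continuous_on_subset differentiable_on_subset)

lemma Ck_on_cong:
  assumes "open S" "\<And>x. x \<in> S \<Longrightarrow> f x = g x" "Ck_on k S f"
  shows "Ck_on k S g"
  using assms(2,3)
proof (induction k arbitrary: f g)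
  case 0
  thus ?case using continuous_on_cong[of S S f g] by simp
next
  case (Suc k)
  have d: "g differentiable_on S"
    using Suc.prems by (simp add: differentiable_on_def differentiable_def)
      (metis has_derivative_transform)
  have "Ck_on k S (\<lambda>x. fder g x v)" for v
    using Suc.IH[of "\<lambda>x. fder f x v" "\<lambda>x. fder g x v"] Suc.prems fder_cong[OF assms(1), of _ f g] by simp
  with d show ?case by simp
qed

lemma Ck_on_const: "Ck_on k S (\<lambda>x. c)"
  by (induction k arbitrary: c) (auto simp: frechet_derivative_const)

lemma Ck_on_add:
  assumes "open S" "Ck_on k S f" "Ck_on k S g"
  shows "Ck_on k S (\<lambda>x. f x + g x)"
  using assms(2,3)
proof (induction k arbitrary: f g)
  case 0
  thus ?case by (simp add: continuous_on_add)
next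
  case (Suc k)
  have eq: "fder f x v + fder g x v = fder (\<lambda>x. f x + g x) x v" if "x \<in> S" for x v
    using Suc.prems that assms(1)
    by (subst fder_eq[OF has_derivative_add[OF fder_works fder_works]])
       (auto simp: differentiable_on_eq_differentiable_at)
  have c: "Ck_on k S (\<lambda>x. fder f x v + fder g x v)" for v
    using Suc.prems by (intro Suc.IH) auto
  have "Ck_on k S (\<lambda>x. fder (\<lambda>x. f x + g x) x v)" for v
    by (rule Ck_on_cong[OF assms(1) eq c])
  thus ?case using Suc.prems by (simp add: differentiable_on_add)
qed

lemma Ck_on_sum:
  assumes "open S" "\<And>i. i \<in> I \<Longrightarrow> Ck_on k S (f i)"
  shows "Ck_on k S (\<lambda>x. \<Sum>i\<in>I. f i x)"
  using assms(2) by (induction I rule: infinite_finite_induct) (auto intro: Ck_on_const Ck_on_add[OF assms(1)])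

lemma Ck_on_scaleR:
  fixes f :: "'e::euclidean_space \<Rightarrow> real"
  assumes "open S" "Ck_on k S f" "Ck_on k S g"
  shows "Ck_on k S (\<lambda>x. f x *\<^sub>R g x)"
  using assms(2,3)
proof (induction k arbitrary: f g)
  case 0
  thus ?case by (simp add: continuous_on_scaleR)
next
  case (Suc k)
  have d: "f differentiable (at x)" "g differentiable (at x)" if "x \<in> S" for x
    using Suc.prems that assms(1) by (auto simp: differentiable_on_eq_differentiable_at)
  have eq: "f x *\<^sub>R fder g x v + fder f x v *\<^sub>R g x = fder (\<lambda>x. f x *\<^sub>R g x) x v" if "x \<in> S" for x v
    using d[OF that] by (subst fder_eq[OF has_derivative_scaleR[OF fder_works fder_works]]) auto
  have c: "Ck_on k S (\<lambda>x. f x *\<^sub>R fder g x v + fder f x v *\<^sub>R g x)" for v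
    using Suc.prems Ck_on_Suc_D[OF Suc.prems(1)] Ck_on_Suc_D[OF Suc.prems(2)]
    by (intro Ck_on_add[OF assms(1)] Suc.IH) auto
  have "Ck_on k S (\<lambda>x. fder (\<lambda>x. f x *\<^sub>R g x) x v)" for v
    by (rule Ck_on_cong[OF assms(1) eq c])
  moreover have "(\<lambda>x. f x *\<^sub>R g x) differentiable_on S"
    using d assms(1) by (auto simp: differentiable_on_eq_differentiable_at)
  ultimately show ?case by simp
qed

lemma Ck_on_linear:
  assumes "open S" "bounded_linear h" "Ck_on k S f"
  shows "Ck_on k S (\<lambda>x. h (f x))"
  using assms(3)
proof (induction k arbitrary: f)
  case 0
  thus ?case using assms(2) by (simp add: bounded_linear.continuous_on)
next
  case (Suc k)
  have d: "((\<lambda>x. h (f x)) has_derivative (\<lambda>v. h (fder f x v))) (at x)" if "x \<in> S" for x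
    using Suc.prems that assms(1)
    by (intro bounded_linear.has_derivative[OF assms(2)] fder_works)
       (auto simp: differentiable_on_eq_differentiable_at)
  have eq: "h (fder f x v) = fder (\<lambda>x. h (f x)) x v" if "x \<in> S" for x v
    by (simp add: fder_eq[OF d[OF that]])
  have c: "Ck_on k S (\<lambda>x. h (fder f x v))" for v
    using Suc.prems by (intro Suc.IH) auto
  have "Ck_on k S (\<lambda>x. fder (\<lambda>x. h (f x)) x v)" for v
    by (rule Ck_on_cong[OF assms(1) eq c])
  moreover have "(\<lambda>x. h (f x)) differentiable_on S"
    using d assms(1) by (auto simp: differentiable_on_eq_differentiable_at differentiable_def)
  ultimately show ?case by simp
qed

text \<open>Expanding the inner derivative in the standard basis writes the derivative of the composite as a
  sum of products to which the induction hypothesis applies.\<close>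

lemma Ck_on_compose:
  fixes f :: "'e::euclidean_space \<Rightarrow> 'f::real_normed_vector"
    and h :: "'d::euclidean_space \<Rightarrow> 'e"
  assumes "open S" "open T" "h ` S \<subseteq> T" "Ck_on k T f" "Ck_on k S h"
  shows "Ck_on k S (\<lambda>x. f (h x))"
  using assms(4,5)
proof (induction k arbitrary: f)
  case 0
  thus ?case using assms(3) by (auto intro: continuous_on_compose2)
next
  case (Suc k)
  have f: "f differentiable (at y)" if "y \<in> T" for y
    using Suc.prems that assms(2) by (auto simp: differentiable_on_eq_differentiable_at)
  have h: "h differentiable (at x)" if "x \<in> S" for x
    using Suc.prems that assms(1) by (auto simp: differentiable_on_eq_differentiable_at)
  have d: "((\<lambda>x. f (h x)) has_derivative (\<lambda>v. fder f (h x) (fder h x v))) (at x)" if "x \<in> S" for x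
    using assms(3) that by (intro has_derivative_compose[OF fder_works[OF h] fder_works[OF f]]) auto
  have eq: "(\<Sum>b\<in>Basis. (fder h x v \<bullet> b) *\<^sub>R fder f (h x) b) = fder (\<lambda>x. f (h x)) x v" if "x \<in> S" for x v
  proof -
    interpret linear "fder f (h x)" using assms(3) that f by (intro fder_linear) auto
    have "fder f (h x) (fder h x v) = fder f (h x) (\<Sum>b\<in>Basis. (fder h x v \<bullet> b) *\<^sub>R b)"
      by (simp add: euclidean_representation)
    also have "\<dots> = (\<Sum>b\<in>Basis. (fder h x v \<bullet> b) *\<^sub>R fder f (h x) b)"
      by (simp add: sum scale)
    finally show ?thesis using fder_eq[OF d[OF that]] by simp
  qed
  have "Ck_on k S (\<lambda>x. \<Sum>b\<in>Basis. (fder h x v \<bullet> b) *\<^sub>R fder f (h x) b)" for v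
    using Suc.prems Ck_on_Suc_D[OF Suc.prems(2)]
    by (intro Ck_on_sum Ck_on_scaleR Ck_on_linear[OF _ bounded_linear_inner_left] Suc.IH assms(1)) auto
  from Ck_on_cong[OF assms(1) eq this]
  have "Ck_on k S (\<lambda>x. fder (\<lambda>x. f (h x)) x v)" for v by simp
  moreover have "(\<lambda>x. f (h x)) differentiable_on S"
    using d assms(1) by (auto simp: differentiable_on_eq_differentiable_at differentiable_def)
  ultimately show ?case by simp
qed

lemma smooth_on_subset: "smooth_on S f \<Longrightarrow> T \<subseteq> S \<Longrightarrow> smooth_on T f"
  by (auto simp: smooth_on_def intro: Ck_on_subset)

lemma smooth_on_cong:
  "open S \<Longrightarrow> (\<And>x. x \<in> S \<Longrightarrow> f x = g x) \<Longrightarrow> smooth_on S f \<Longrightarrow> smooth_on S g"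
  using Ck_on_cong unfolding smooth_on_def by metis

lemma smooth_on_const: "smooth_on S (\<lambda>x. c)"
  by (simp add: smooth_on_def Ck_on_const)

lemma smooth_on_add:
  "open S \<Longrightarrow> smooth_on S f \<Longrightarrow> smooth_on S g \<Longrightarrow> smooth_on S (\<lambda>x. f x + g x)"
  by (simp add: smooth_on_def Ck_on_add)

lemma smooth_on_scaleR:
  fixes f :: "'e::euclidean_space \<Rightarrow> real"
  shows "open S \<Longrightarrow> smooth_on S f \<Longrightarrow> smooth_on S g \<Longrightarrow> smooth_on S (\<lambda>x. f x *\<^sub>R g x)"
  by (simp add: smooth_on_def Ck_on_scaleR)

lemma smooth_on_linear:
  "open S \<Longrightarrow> bounded_linear h \<Longrightarrow> smooth_on S f \<Longrightarrow> smooth_on S (\<lambda>x. h (f x))"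
  by (simp add: smooth_on_def Ck_on_linear)

lemma smooth_on_compose:
  fixes f :: "'e::euclidean_space \<Rightarrow> 'f::real_normed_vector"
    and h :: "'d::euclidean_space \<Rightarrow> 'e"
  shows "open S \<Longrightarrow> open T \<Longrightarrow> h ` S \<subseteq> T \<Longrightarrow> smooth_on T f \<Longrightarrow> smooth_on S h \<Longrightarrow>
    smooth_on S (\<lambda>x. f (h x))"
  using Ck_on_compose unfolding smooth_on_def by blast

lemma smooth_on_fder: "smooth_on S f \<Longrightarrow> smooth_on S (\<lambda>x. fder f x v)"
  by (metis Ck_on.simps(2) smooth_on_def)

lemma smooth_on_differentiable: "smooth_on S f \<Longrightarrow> open S \<Longrightarrow> x \<in> S \<Longrightarrow> f differentiable (at x)"
  by (metis Ck_on.simps(2) smooth_on_def differentiable_on_eq_differentiable_at)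

lemma smooth_on_continuous: "smooth_on S f \<Longrightarrow> continuous_on S f"
  by (metis Ck_on.simps(1) smooth_on_def)

lemma fder_along_curve:
  fixes f :: "'e::real_normed_vector \<Rightarrow> real"
  assumes h: "(h has_derivative (\<lambda>s. s *\<^sub>R u)) (at a)" and f: "f differentiable (at (h a))"
  shows "((\<lambda>s. f (h s)) has_real_derivative fder f (h a) u) (at a)"
proof -
  have "((\<lambda>s. f (h s)) has_derivative (\<lambda>s. fder f (h a) (s *\<^sub>R u))) (at a)"
    using has_derivative_compose[where f = h and g = f and g' = "fder f (h a)", OF h fder_works[OF f]] .
  thus ?thesis
    by (simp add: has_field_derivative_def linear_cmul[OF fder_linear[OF f]] mult_commute_abs)
qed

text \<open>Applying the mean value theorem first in the direction \<open>v\<close> and then in the direction \<open>w\<close>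
  turns the second difference of \<open>f\<close> over a small parallelogram into a value of the iterated
  derivative.  The second difference is symmetric in \<open>v\<close> and \<open>w\<close>.\<close>

lemma second_difference_mvt:
  fixes f :: "'e::euclidean_space \<Rightarrow> real"
  assumes S: "open S" "smooth_on S f" and t: "t > 0"
    and box: "\<And>a b. 0 \<le> a \<Longrightarrow> a \<le> t \<Longrightarrow> 0 \<le> b \<Longrightarrow> b \<le> t \<Longrightarrow> x + a *\<^sub>R v + b *\<^sub>R w \<in> S"
  obtains a b where "0 \<le> a" "a \<le> t" "0 \<le> b" "b \<le> t"
    "f (x + t *\<^sub>R v + t *\<^sub>R w) - f (x + t *\<^sub>R v) - f (x + t *\<^sub>R w) + f x
      = t * t * fder (\<lambda>y. fder f y v) (x + a *\<^sub>R v + b *\<^sub>R w) w"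
proof -
  have f: "f differentiable (at y)" if "y \<in> S" for y
    using S that by (intro smooth_on_differentiable)
  have f': "(\<lambda>y. fder f y v) differentiable (at y)" if "y \<in> S" for y
    using S that by (intro smooth_on_differentiable smooth_on_fder)
  define \<phi> where "\<phi> a = f (x + a *\<^sub>R v + t *\<^sub>R w) - f (x + a *\<^sub>R v + 0 *\<^sub>R w)" for a
  have 1: "((\<lambda>a. f (x + a *\<^sub>R v + b *\<^sub>R w)) has_real_derivative fder f (x + a *\<^sub>R v + b *\<^sub>R w) v) (at a)"
    if "0 \<le> a" "a \<le> t" "0 \<le> b" "b \<le> t" for a b
    using that by (intro fder_along_curve f box) (auto intro!: derivative_eq_intros)
  have "(\<phi> has_real_derivative fder f (x + a *\<^sub>R v + t *\<^sub>R w) v - fder f (x + a *\<^sub>R v + 0 *\<^sub>R w) v) (at a)"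
    if "0 \<le> a" "a \<le> t" for a
    unfolding \<phi>_def using that t by (intro DERIV_diff 1) auto
  from MVT2[OF t this]
  obtain a where a: "0 < a" "a < t"
    "\<phi> t - \<phi> 0 = t * (fder f (x + a *\<^sub>R v + t *\<^sub>R w) v - fder f (x + a *\<^sub>R v + 0 *\<^sub>R w) v)"
    by auto
  define \<psi> where "\<psi> b = fder f (x + a *\<^sub>R v + b *\<^sub>R w) v" for b
  have 2: "(\<psi> has_real_derivative fder (\<lambda>y. fder f y v) (x + a *\<^sub>R v + b *\<^sub>R w) w) (at b)"
    if "0 \<le> b" "b \<le> t" for b
    unfolding \<psi>_def using that a by (intro fder_along_curve f' box) (auto intro!: derivative_eq_intros)
  from MVT2[OF t this]
  obtain b where b: "0 < b" "b < t"
    "\<psi> t - \<psi> 0 = t * fder (\<lambda>y. fder f y v) (x + a *\<^sub>R v + b *\<^sub>R w) w"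
    by auto
  show ?thesis
    by (rule that[of a b]) (use a b in \<open>auto simp: \<phi>_def \<psi>_def\<close>)
qed

lemma second_derivative_symmetric:
  fixes f :: "'e::euclidean_space \<Rightarrow> real"
  assumes S: "open S" "smooth_on S f" and x: "x \<in> S"
  shows "fder (\<lambda>y. fder f y v) x w = fder (\<lambda>y. fder f y w) x v"
proof -
  define F where "F y = fder (\<lambda>y. fder f y v) y w" for y
  define G where "G y = fder (\<lambda>y. fder f y w) y v" for y
  have "continuous_on S F" "continuous_on S G" unfolding F_def G_def
    using S by (auto intro!: smooth_on_continuous smooth_on_fder)
  hence "isCont F x" "isCont G x" using S x by (auto simp: continuous_on_eq_continuous_at)
  hence c: "(F \<longlongrightarrow> F x) (nhds x)" "(G \<longlongrightarrow> G x) (nhds x)"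
    by (auto simp: isCont_def tendsto_at_iff_tendsto_nhds)
  have "\<bar>F x - G x\<bar> \<le> e" if e: "e > 0" for e
  proof -
    have "eventually (\<lambda>y. y \<in> S \<and> dist (F y) (F x) < e/2 \<and> dist (G y) (G x) < e/2) (nhds x)"
      using c[THEN tendstoD, of "e/2"] e S x by (auto intro!: eventually_conj eventually_nhds_in_open)
    then obtain d where d: "d > 0"
      "\<And>y. dist y x < d \<Longrightarrow> y \<in> S \<and> dist (F y) (F x) < e/2 \<and> dist (G y) (G x) < e/2"
      unfolding eventually_nhds_metric by blast
    define m where "m = norm v + norm w + 1"
    define t where "t = d / (2 * m)"
    have n: "m > 0" unfolding m_def by (simp add: add_nonneg_pos)
    have t: "t > 0" unfolding t_def using d(1) n by (intro divide_pos_pos) auto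
    have near: "dist (x + a *\<^sub>R v + b *\<^sub>R w) x < d" if "0 \<le> a" "a \<le> t" "0 \<le> b" "b \<le> t" for a b
    proof -
      have "dist (x + a *\<^sub>R v + b *\<^sub>R w) x \<le> norm (a *\<^sub>R v) + norm (b *\<^sub>R w)"
        by (simp add: dist_norm add.assoc norm_triangle_ineq del: norm_scaleR)
      also have "\<dots> \<le> t * norm v + t * norm w"
        using that by (intro add_mono) (auto intro: mult_right_mono)
      also have "\<dots> < t * m" unfolding m_def using t by (simp add: algebra_simps)
      also have "\<dots> = d / 2" unfolding t_def using n by simp
      finally show ?thesis using d(1) by simp
    qed
    obtain a b where ab: "0 \<le> a" "a \<le> t" "0 \<le> b" "b \<le> t"
      "f (x + t *\<^sub>R v + t *\<^sub>R w) - f (x + t *\<^sub>R v) - f (x + t *\<^sub>R w) + f x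
        = t * t * F (x + a *\<^sub>R v + b *\<^sub>R w)"
      unfolding F_def using second_difference_mvt[OF S t, of x v w] near d(2) by metis
    have near': "dist (x + a *\<^sub>R w + b *\<^sub>R v) x < d" if "0 \<le> a" "a \<le> t" "0 \<le> b" "b \<le> t" for a b
      using near[OF that(3,4,1,2)] by (simp add: add.assoc add.commute[of "a *\<^sub>R w"])
    obtain a' b' where ab': "0 \<le> a'" "a' \<le> t" "0 \<le> b'" "b' \<le> t"
      "f (x + t *\<^sub>R w + t *\<^sub>R v) - f (x + t *\<^sub>R w) - f (x + t *\<^sub>R v) + f x
        = t * t * G (x + a' *\<^sub>R w + b' *\<^sub>R v)"
      unfolding G_def using second_difference_mvt[OF S t, of x w v] near' d(2) by metis
    have "t * t * F (x + a *\<^sub>R v + b *\<^sub>R w) = t * t * G (x + a' *\<^sub>R w + b' *\<^sub>R v)"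
      using ab(5) ab'(5) add.commute[of "t *\<^sub>R v" "t *\<^sub>R w"] by (simp only: add.assoc)
    hence "F (x + a *\<^sub>R v + b *\<^sub>R w) = G (x + a' *\<^sub>R w + b' *\<^sub>R v)" using t by simp
    moreover have "dist (F (x + a *\<^sub>R v + b *\<^sub>R w)) (F x) < e/2"
      using d(2)[OF near[OF ab(1-4)]] by blast
    moreover have "dist (G (x + a' *\<^sub>R w + b' *\<^sub>R v)) (G x) < e/2"
      using d(2)[OF near'[OF ab'(1-4)]] by blast
    ultimately show ?thesis unfolding dist_real_def by linarith
  qed
  hence "\<bar>F x - G x\<bar> \<le> 0" by (rule field_le_epsilon) simp
  thus ?thesis by (simp add: F_def G_def)
qed

text \<open>The derivative of \<open>Y(F)\<close> in the direction \<open>u\<close>.  Thanks to the symmetry of second derivatives, the term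
  without a derivative of \<open>Y\<close> again has the form \<open>D(DF u)(Y)\<close>, so that it cancels in commutators.\<close>

lemma fder_apply_field:
  fixes F :: "'e::euclidean_space \<Rightarrow> real"
  assumes S: "open S" "smooth_on S F" "z \<in> S" and Y: "Y differentiable (at z)"
  shows "fder (\<lambda>z. fder F z (Y z)) z u = fder F z (fder Y z u) + fder (\<lambda>z. fder F z u) z (Y z)"
proof -
  have F: "F differentiable (at y)" if "y \<in> S" for y
    using S that by (intro smooth_on_differentiable)
  have F': "(\<lambda>y. fder F y b) differentiable (at z)" for b
    using S by (intro smooth_on_differentiable[OF smooth_on_fder])
  have expand: "L w = (\<Sum>b\<in>Basis. (w \<bullet> b) * L b)" if "linear L" for L :: "'e \<Rightarrow> real" and w
    using linear_sum[OF that, of "\<lambda>b. (w \<bullet> b) *\<^sub>R b" Basis]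
    by (simp add: euclidean_representation linear_cmul[OF that])
  have "fder (\<lambda>z. fder F z (Y z)) z u = fder (\<lambda>z. \<Sum>b\<in>Basis. (Y z \<bullet> b) * fder F z b) z u"
    using S expand[OF fder_linear[OF F]]
    by (subst fder_cong[OF S(1,3), of _ "\<lambda>z. \<Sum>b\<in>Basis. (Y z \<bullet> b) * fder F z b"]) auto
  also have "\<dots> = (\<Sum>b\<in>Basis. (Y z \<bullet> b) * fder (\<lambda>z. fder F z b) z u + (fder Y z u \<bullet> b) * fder F z b)"
    by (subst fder_eq[OF has_derivative_sum[OF has_derivative_mult
          [OF has_derivative_inner_left[OF fder_works[OF Y]] fder_works[OF F']]]]) simp
  also have "\<dots> = (\<Sum>b\<in>Basis. (Y z \<bullet> b) * fder (\<lambda>z. fder F z u) z b) + fder F z (fder Y z u)"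
    using second_derivative_symmetric[OF S, of _ u] expand[OF fder_linear[OF F[OF S(3)]], of "fder Y z u"]
    by (simp add: sum.distrib)
  also have "\<dots> = fder (\<lambda>z. fder F z u) z (Y z) + fder F z (fder Y z u)"
    using expand[OF fder_linear[OF F'[of u]], of "Y z"] by simp
  finally show ?thesis by simp
qed


section \<open>Calculus in the charts of a smooth manifold\<close>

locale smooth_atlas =
  fixes M :: "'a topology" and A :: "('a, 'n::finite) chart set"
  assumes manifold: "smooth_manifold M A"
begin

lemma chart_open: "c \<in> A \<Longrightarrow> openin M (fst c)"
  using manifold by (simp add: smooth_manifold_def is_chart_def)

lemma chart_inj: "c \<in> A \<Longrightarrow> inj_on (snd c) (fst c)"
proof -
  assume c: "c \<in> A"
  have "homeomorphic_map (subtopology M (fst c)) (top_of_set (snd c ` fst c)) (snd c)"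
    using c manifold by (simp add: smooth_manifold_def is_chart_def)
  hence "inj_on (snd c) (topspace (subtopology M (fst c)))"
    by (rule homeomorphic_imp_injective_map)
  moreover have "topspace (subtopology M (fst c)) = fst c"
    using chart_open[OF c] openin_subset by (auto simp: topspace_subtopology)
  ultimately show ?thesis by simp
qed

lemma chart_inv_left [simp]: "c \<in> A \<Longrightarrow> x \<in> fst c \<Longrightarrow> chart_inv c (snd c x) = x"
  by (simp add: chart_inv_def chart_inj)

lemma chart_image_open:
  assumes c: "c \<in> A" and W: "openin M W"
  shows "open (snd c ` (fst c \<inter> W))"
proof -
  have h: "homeomorphic_map (subtopology M (fst c)) (top_of_set (snd c ` fst c)) (snd c)"
    and o: "open (snd c ` fst c)"
    using c manifold by (auto simp: smooth_manifold_def is_chart_def)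
  have "openin (subtopology M (fst c)) (fst c \<inter> W)"
    using W by (auto simp: openin_subtopology)
  hence "openin (top_of_set (snd c ` fst c)) (snd c ` (fst c \<inter> W))"
    using homeomorphic_imp_open_map[OF h] unfolding open_map_def by blast
  thus ?thesis using o openin_open_trans by blast
qed

lemma chart_at: "x \<in> topspace M \<Longrightarrow> chart_at A x \<in> A \<and> x \<in> fst (chart_at A x)"
proof -
  assume "x \<in> topspace M"
  moreover have "(\<Union>c\<in>A. fst c) = topspace M" using manifold by (simp add: smooth_manifold_def)
  ultimately have "\<exists>c. c \<in> A \<and> x \<in> fst c" by blast
  thus ?thesis unfolding chart_at_def by (rule someI_ex)
qed

lemma chart_topspace: "c \<in> A \<Longrightarrow> x \<in> fst c \<Longrightarrow> x \<in> topspace M"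
  using chart_open openin_subset by blast

lemma transition_smooth:
  "c \<in> A \<Longrightarrow> c' \<in> A \<Longrightarrow> smooth_on (snd c ` (fst c \<inter> fst c')) (snd c' \<circ> chart_inv c)"
  using manifold by (simp add: smooth_manifold_def)

lemma transition_differentiable:
  "c \<in> A \<Longrightarrow> c' \<in> A \<Longrightarrow> x \<in> fst c \<Longrightarrow> x \<in> fst c' \<Longrightarrow>
    (snd c' \<circ> chart_inv c) differentiable (at (snd c x))"
  using transition_smooth chart_image_open chart_open
  by (intro smooth_on_differentiable[where S = "snd c ` (fst c \<inter> fst c')"]) auto

text \<open>The chain rule for \<open>F \<circ> c\<^sup>-\<^sup>1 = (F \<circ> c'\<^sup>-\<^sup>1) \<circ> (c' \<circ> c\<^sup>-\<^sup>1)\<close>.  It makes quantities that are defined in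
  the preferred chart of each point computable in one fixed chart.\<close>

lemma chart_change:
  fixes F :: "'a \<Rightarrow> 'b::real_normed_vector"
  assumes c: "c \<in> A" "c' \<in> A" "x \<in> fst c" "x \<in> fst c'"
    and F: "(F \<circ> chart_inv c') differentiable (at (snd c' x))"
  shows "fder (F \<circ> chart_inv c) (snd c x) v =
    fder (F \<circ> chart_inv c') (snd c' x) (fder (snd c' \<circ> chart_inv c) (snd c x) v)"
proof -
  let ?S = "snd c ` (fst c \<inter> fst c')"
  have S: "open ?S" "snd c x \<in> ?S" using c chart_image_open chart_open by auto
  have "fder (F \<circ> chart_inv c) (snd c x) =
      fder (\<lambda>z. (F \<circ> chart_inv c') ((snd c' \<circ> chart_inv c) z)) (snd c x)"
    using c by (intro fder_cong[OF S]) auto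
  also have "\<dots> = (\<lambda>v. fder (F \<circ> chart_inv c') (snd c' x) (fder (snd c' \<circ> chart_inv c) (snd c x) v))"
  proof (rule fder_eq, rule has_derivative_compose[where f = "snd c' \<circ> chart_inv c" and g = "F \<circ> chart_inv c'"])
    show "(snd c' \<circ> chart_inv c has_derivative fder (snd c' \<circ> chart_inv c) (snd c x)) (at (snd c x))"
      using c by (intro fder_works transition_differentiable)
    have "(snd c' \<circ> chart_inv c) (snd c x) = snd c' x" using c by simp
    thus "(F \<circ> chart_inv c' has_derivative fder (F \<circ> chart_inv c') (snd c' x))
        (at ((snd c' \<circ> chart_inv c) (snd c x)))"
      using fder_works[OF F] by metis
  qed
  finally show ?thesis by simp
qed

lemma fder_chart_self:
  assumes "c \<in> A" "x \<in> fst c"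
  shows "fder (snd c \<circ> chart_inv c) (snd c x) v = v"
proof -
  have "fder (snd c \<circ> chart_inv c) (snd c x) = fder (\<lambda>z. z) (snd c x)"
    using assms chart_image_open[OF assms(1) chart_open[OF assms(1)]]
    by (intro fder_cong[of "snd c ` fst c"]) auto
  thus ?thesis by (simp add: fder_eq[OF has_derivative_ident])
qed

lemma components_change:
  assumes "c \<in> A" "c' \<in> A" "x \<in> fst c" "x \<in> fst c'"
  shows "components A c' x v = fder (snd c' \<circ> chart_inv c) (snd c x) (components A c x v)"
  unfolding components_def using assms chart_at[OF chart_topspace[OF assms(1,3)]]
  by (intro chart_change transition_differentiable) auto

lemma components_self: "x \<in> topspace M \<Longrightarrow> components A (chart_at A x) x v = v"
  unfolding components_def using chart_at by (simp add: fder_chart_self)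

lemma components_linear: "c \<in> A \<Longrightarrow> x \<in> fst c \<Longrightarrow> linear (components A c x)"
proof -
  assume c: "c \<in> A" "x \<in> fst c"
  have "components A c x = fder (snd c \<circ> chart_inv (chart_at A x)) (snd (chart_at A x) x)"
    by (auto simp: components_def)
  thus ?thesis using c chart_at[OF chart_topspace[OF c]]
    by (simp add: fder_linear transition_differentiable)
qed

text \<open>The field with constant components \<open>v\<close> in the chart \<open>c\<close>.\<close>

definition coord_field :: "('a, 'n) chart \<Rightarrow> real ^ 'n \<Rightarrow> 'a \<Rightarrow> real ^ 'n" where
  "coord_field c v x = fder (snd (chart_at A x) \<circ> chart_inv c) (snd c x) v"

lemma components_coord_field:
  assumes c: "c \<in> A" "x \<in> fst c"
  shows "components A c x (coord_field c v x) = v"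
  unfolding components_def coord_field_def
  using c chart_at[OF chart_topspace[OF c]] chart_change[of c "chart_at A x" x "snd c" v]
  by (simp add: transition_differentiable fder_chart_self)

lemma coord_field_components:
  assumes c: "c \<in> A" "x \<in> fst c"
  shows "coord_field c (components A c x v) x = v"
  using c chart_at[OF chart_topspace[OF c]] components_change[of c "chart_at A x" x v]
    components_self[OF chart_topspace[OF c]] by (simp add: coord_field_def)

lemma coord_field_linear: "c \<in> A \<Longrightarrow> x \<in> fst c \<Longrightarrow> linear (\<lambda>v. coord_field c v x)"
  unfolding coord_field_def using chart_at[OF chart_topspace]
  by (simp add: fder_linear transition_differentiable)

lemma coord_field_expansion:
  assumes c: "c \<in> A" "x \<in> fst c"
  shows "v = (\<Sum>i\<in>UNIV. (components A c x v $ i) *\<^sub>R coord_field c (axis i 1) x)"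
proof -
  have "v = coord_field c (\<Sum>i\<in>UNIV. (components A c x v $ i) *\<^sub>R axis i 1) x"
    using basis_expansion[of "components A c x v"] coord_field_components[OF c]
    by (simp add: scalar_mult_eq_scaleR)
  also have "\<dots> = (\<Sum>i\<in>UNIV. (components A c x v $ i) *\<^sub>R coord_field c (axis i 1) x)"
    by (simp add: linear_sum[OF coord_field_linear[OF c]] linear_cmul[OF coord_field_linear[OF c]])
  finally show ?thesis .
qed


subsection \<open>Smooth functions and fields\<close>

lemma smooth_field_subset: "smooth_field A W X \<Longrightarrow> V \<subseteq> W \<Longrightarrow> smooth_field A V X"
  unfolding smooth_field_def by (metis Int_mono image_mono order_refl smooth_on_subset)

lemma smooth_fun_cong:
  assumes "openin M W" "\<And>x. x \<in> W \<Longrightarrow> f x = h x" "smooth_fun A W f"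
  shows "smooth_fun A W h"
  unfolding smooth_fun_def
proof
  fix c assume c: "c \<in> A"
  show "smooth_on (snd c ` (fst c \<inter> W)) (h \<circ> chart_inv c)"
    by (rule smooth_on_cong[OF chart_image_open[OF c assms(1)], where f = "f \<circ> chart_inv c"])
       (use assms c in \<open>auto simp: smooth_fun_def\<close>)
qed

lemma smooth_field_cong:
  assumes "openin M W" "\<And>x. x \<in> W \<Longrightarrow> X x = Y x" "smooth_field A W X"
  shows "smooth_field A W Y"
  unfolding smooth_field_def
proof
  fix c assume c: "c \<in> A"
  show "smooth_on (snd c ` (fst c \<inter> W)) (local_rep A c Y)"
    by (rule smooth_on_cong[OF chart_image_open[OF c assms(1)], where f = "local_rep A c X"])
       (use assms c in \<open>auto simp: smooth_field_def local_rep_def\<close>)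
qed

lemma smooth_fun_const: "smooth_fun A W (\<lambda>x. k)"
  by (simp add: smooth_fun_def comp_def smooth_on_const)

lemma smooth_field_add:
  assumes W: "openin M W" and X: "smooth_field A W X" "smooth_field A W Y"
  shows "smooth_field A W (\<lambda>x. X x + Y x)"
  unfolding smooth_field_def
proof
  fix c assume c: "c \<in> A"
  have "smooth_on (snd c ` (fst c \<inter> W)) (\<lambda>z. local_rep A c X z + local_rep A c Y z)"
    using X c by (intro smooth_on_add chart_image_open W) (auto simp: smooth_field_def)
  thus "smooth_on (snd c ` (fst c \<inter> W)) (local_rep A c (\<lambda>x. X x + Y x))"
    by (rule smooth_on_cong[OF chart_image_open[OF c W], rotated])
       (auto simp: local_rep_def c linear_add[OF components_linear])
qed

lemma smooth_field_scale:
  assumes W: "openin M W" and X: "smooth_fun A W f" "smooth_field A W X"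
  shows "smooth_field A W (\<lambda>x. f x *\<^sub>R X x)"
  unfolding smooth_field_def
proof
  fix c assume c: "c \<in> A"
  have "smooth_on (snd c ` (fst c \<inter> W)) (\<lambda>z. (f \<circ> chart_inv c) z *\<^sub>R local_rep A c X z)"
    using X c by (intro smooth_on_scaleR chart_image_open W) (auto simp: smooth_field_def smooth_fun_def comp_def)
  thus "smooth_on (snd c ` (fst c \<inter> W)) (local_rep A c (\<lambda>x. f x *\<^sub>R X x))"
    by (rule smooth_on_cong[OF chart_image_open[OF c W], rotated])
       (auto simp: local_rep_def c linear_cmul[OF components_linear])
qed

lemma smooth_field_zero: "openin M W \<Longrightarrow> smooth_field A W (\<lambda>x. 0)"
  unfolding smooth_field_def
proof
  fix c assume W: "openin M W" and c: "c \<in> A"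
  show "smooth_on (snd c ` (fst c \<inter> W)) (local_rep A c (\<lambda>x. 0))"
    by (rule smooth_on_cong[OF chart_image_open[OF c W] _ smooth_on_const[of _ 0]])
       (auto simp: local_rep_def c linear_0[OF components_linear])
qed

lemma smooth_field_sum:
  assumes "openin M W" "\<And>i. i \<in> I \<Longrightarrow> smooth_field A W (X i)"
  shows "smooth_field A W (\<lambda>x. \<Sum>i\<in>I. X i x)"
  using assms(2)
  by (induction I rule: infinite_finite_induct)
     (auto intro: smooth_field_zero smooth_field_add assms(1))

lemma smooth_field_diff:
  assumes W: "openin M W" and X: "smooth_field A W X" "smooth_field A W Y"
  shows "smooth_field A W (\<lambda>x. X x - Y x)"
  using smooth_field_add[OF W X(1) smooth_field_scale[OF W smooth_fun_const[of _ "-1"] X(2)]]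
  by simp

text \<open>In another chart \<open>c'\<close> the components of a coordinate field are directional derivatives of the
  transition map from \<open>c\<close> to \<open>c'\<close>, read at the image of the point in \<open>c\<close>.\<close>

lemma smooth_field_coord_field:
  assumes c: "c \<in> A"
  shows "smooth_field A (fst c) (coord_field c v)"
  unfolding smooth_field_def
proof
  fix c' assume c': "c' \<in> A"
  let ?S = "snd c' ` (fst c' \<inter> fst c)" and ?T = "snd c ` (fst c \<inter> fst c')"
  have o: "open ?S" "open ?T" using c c' by (auto intro: chart_image_open chart_open)
  have "smooth_on ?S (\<lambda>z. fder (snd c' \<circ> chart_inv c) ((snd c \<circ> chart_inv c') z) v)"
    using c c' by (intro smooth_on_compose[OF o, of "snd c \<circ> chart_inv c'" "\<lambda>w. fder (snd c' \<circ> chart_inv c) w v"]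
      smooth_on_fder transition_smooth) auto
  thus "smooth_on ?S (local_rep A c' (coord_field c v))"
    by (rule smooth_on_cong[OF o(1), rotated])
       (use c c' components_change[OF c c'] components_coord_field[OF c] in \<open>auto simp: local_rep_def\<close>)
qed

lemma smooth_fun_component:
  assumes W: "openin M W" and c: "c \<in> A" "W \<subseteq> fst c" and X: "smooth_field A W X"
  shows "smooth_fun A W (\<lambda>x. components A c x (X x) $ i)"
  unfolding smooth_fun_def
proof
  fix c' assume c': "c' \<in> A"
  let ?S = "snd c' ` (fst c' \<inter> W)" and ?T = "snd c ` (fst c \<inter> W)"
  have o: "open ?S" "open ?T" using c c' W by (auto intro: chart_image_open)
  have "smooth_on ?S (snd c \<circ> chart_inv c')"
    using c c' by (intro smooth_on_subset[OF transition_smooth]) auto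
  hence "smooth_on ?S (\<lambda>z. local_rep A c X ((snd c \<circ> chart_inv c') z) $ i)"
    using c c' X
    by (intro smooth_on_compose[OF o, of "snd c \<circ> chart_inv c'" "\<lambda>w. local_rep A c X w $ i"]
      smooth_on_linear[OF o(2) bounded_linear_vec_nth]) (auto simp: smooth_field_def)
  thus "smooth_on ?S ((\<lambda>x. components A c x (X x) $ i) \<circ> chart_inv c')"
    by (rule smooth_on_cong[OF o(1), rotated]) (use c c' in \<open>auto simp: local_rep_def subset_eq\<close>)
qed

lemma smooth_fun_coordinate:
  assumes c: "c \<in> A"
  shows "smooth_fun A (fst c) (\<lambda>x. snd c x $ i)"
  unfolding smooth_fun_def
proof
  fix c' assume c': "c' \<in> A"
  have "smooth_on (snd c' ` (fst c' \<inter> fst c)) (\<lambda>z. (snd c \<circ> chart_inv c') z $ i)"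
    by (rule smooth_on_linear[OF chart_image_open[OF c' chart_open[OF c]] bounded_linear_vec_nth
          transition_smooth[OF c' c]])
  thus "smooth_on (snd c' ` (fst c' \<inter> fst c)) ((\<lambda>x. snd c x $ i) \<circ> chart_inv c')"
    by (simp add: comp_def)
qed

lemma smooth_fun_differentiable:
  assumes "openin M W" "smooth_fun A W f" "x \<in> W" "c \<in> A" "x \<in> fst c"
  shows "(f \<circ> chart_inv c) differentiable (at (snd c x))"
  using assms by (intro smooth_on_differentiable[of "snd c ` (fst c \<inter> W)"] chart_image_open)
    (auto simp: smooth_fun_def)


subsection \<open>Directional derivatives and the Lie bracket\<close>

lemma dir_deriv_chart:
  assumes W: "openin M W" "smooth_fun A W f" "x \<in> W" and c: "c \<in> A" "x \<in> fst c"
  shows "dir_deriv A X f x = fder (f \<circ> chart_inv c) (snd c x) (components A c x (X x))"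
  unfolding dir_deriv_def components_def
  using c chart_at[OF chart_topspace[OF c]] smooth_fun_differentiable[OF W c]
  by (intro chart_change) auto

lemma dir_deriv_cong:
  assumes "openin M W" "x \<in> W" "\<And>y. y \<in> W \<Longrightarrow> f y = h y"
  shows "dir_deriv A X f x = dir_deriv A X h x"
proof -
  have x: "chart_at A x \<in> A" "x \<in> fst (chart_at A x)"
    using assms chart_at openin_subset by blast+
  show ?thesis unfolding dir_deriv_def
    using x assms
    by (subst fder_cong[of "snd (chart_at A x) ` (fst (chart_at A x) \<inter> W)" _ "f \<circ> chart_inv (chart_at A x)"
          "h \<circ> chart_inv (chart_at A x)"]) (auto intro: chart_image_open)
qed

lemma dir_deriv_const: "dir_deriv A X (\<lambda>y. k) x = 0"
  by (simp add: dir_deriv_def comp_def frechet_derivative_const)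

lemma dir_deriv_works:
  assumes "openin M W" "x \<in> W" "smooth_fun A W f"
  shows "(f \<circ> chart_inv (chart_at A x) has_derivative
    (\<lambda>v. fder (f \<circ> chart_inv (chart_at A x)) (snd (chart_at A x) x) v)) (at (snd (chart_at A x) x))"
proof -
  have x: "chart_at A x \<in> A" "x \<in> fst (chart_at A x)"
    using assms chart_at openin_subset by blast+
  show ?thesis using fder_works[OF smooth_fun_differentiable[OF assms(1,3,2) x]] by simp
qed

lemma dir_deriv_add:
  assumes "openin M W" "x \<in> W" "smooth_fun A W f" "smooth_fun A W h"
  shows "dir_deriv A X (\<lambda>y. f y + h y) x = dir_deriv A X f x + dir_deriv A X h x"
  unfolding dir_deriv_def
  using fder_eq[OF has_derivative_add[OF dir_deriv_works[OF assms(1,2,3)] dir_deriv_works[OF assms(1,2,4)]]]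
  by (simp add: comp_def)

lemma dir_deriv_mult:
  assumes "openin M W" "x \<in> W" "smooth_fun A W f" "smooth_fun A W h"
  shows "dir_deriv A X (\<lambda>y. f y * h y) x = f x * dir_deriv A X h x + dir_deriv A X f x * h x"
proof -
  have x: "chart_at A x \<in> A" "x \<in> fst (chart_at A x)"
    using assms chart_at openin_subset by blast+
  show ?thesis
    unfolding dir_deriv_def
    using fder_eq[OF has_derivative_mult[OF dir_deriv_works[OF assms(1,2,3)] dir_deriv_works[OF assms(1,2,4)]]] x
    by (simp add: comp_def)
qed

text \<open>In the chart at \<open>x\<close> both iterated derivatives contain the second derivative of \<open>f\<close> in the
  directions \<open>X\<close> and \<open>Y\<close>; these cancel by symmetry and leave the bracket.\<close>

lemma lie_bracket_commutator:
  assumes W: "openin M W" "x \<in> W" and X: "smooth_field A W X" and Y: "smooth_field A W Y"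
    and f: "smooth_fun A W f"
  shows "dir_deriv A X (dir_deriv A Y f) x - dir_deriv A Y (dir_deriv A X f) x =
    dir_deriv A (lie_bracket A X Y) f x"
proof -
  define c where "c = chart_at A x"
  have c: "c \<in> A" "x \<in> fst c" using W chart_at openin_subset unfolding c_def by blast+
  have xM: "x \<in> topspace M" using c chart_topspace by blast
  define S z F where "S = snd c ` (fst c \<inter> W)" and "z = snd c x" and "F = f \<circ> chart_inv c"
  have S: "open S" "smooth_on S F" "z \<in> S"
    using c W f chart_image_open by (auto simp: S_def F_def z_def smooth_fun_def)
  have d: "local_rep A c V differentiable (at z)" if "smooth_field A W V" for V
    using that c S by (intro smooth_on_differentiable[of S]) (auto simp: S_def smooth_field_def)
  have rep: "local_rep A c V z = V x" for V
    using c components_self[OF xM] by (simp add: local_rep_def z_def flip: c_def)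
  have iter: "dir_deriv A U (dir_deriv A V f) x =
      fder F z (fder (local_rep A c V) z (U x)) + fder (\<lambda>z. fder F z (U x)) z (V x)"
    if "smooth_field A W V" for U V
  proof -
    have "fder (dir_deriv A V f \<circ> chart_inv c) z = fder (\<lambda>z. fder F z (local_rep A c V z)) z"
      using c W f dir_deriv_chart[OF W(1) f _ c(1)]
      by (intro fder_cong[OF S(1,3)]) (auto simp: S_def F_def local_rep_def)
    thus ?thesis
      using fder_apply_field[OF S d[OF that]] rep unfolding dir_deriv_def
      by (simp flip: c_def z_def)
  qed
  have lin: "linear (fder F z)" using S by (intro fder_linear smooth_on_differentiable[of S])
  show ?thesis
    unfolding iter[OF X] iter[OF Y] second_derivative_symmetric[OF S, of "Y x" "X x"]
    by (simp add: dir_deriv_def lie_bracket_def Let_def linear_diff[OF lin] flip: c_def z_def F_def)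
qed

lemma dir_deriv_coordinate:
  assumes c: "c \<in> A" "x \<in> fst c"
  shows "dir_deriv A X (\<lambda>x. snd c x $ i) x = components A c x (X x) $ i"
proof -
  have d: "(snd c \<circ> chart_inv c has_derivative (\<lambda>v. v)) (at (snd c x))"
    using fder_works[OF transition_differentiable[OF c(1,1) c(2,2)]]
    unfolding ext[of "fder (snd c \<circ> chart_inv c) (snd c x)" "\<lambda>v. v", OF fder_chart_self[OF c]] .
  have "fder (\<lambda>z. (snd c \<circ> chart_inv c) z $ i) (snd c x) = (\<lambda>v. v $ i)"
    by (intro fder_eq bounded_linear.has_derivative[OF bounded_linear_vec_nth d])
  thus ?thesis
    using dir_deriv_chart[OF chart_open smooth_fun_coordinate c(2) c] c by (simp add: comp_def)
qed

text \<open>The derivative of a coordinate function along a coordinate field is constant.  Hence the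
  commutator of two coordinate fields annihilates all coordinate functions.\<close>

lemma lie_bracket_coord_field:
  assumes c: "c \<in> A" "x \<in> fst c"
  shows "lie_bracket A (coord_field c u) (coord_field c v) x = 0"
proof -
  let ?L = "lie_bracket A (coord_field c u) (coord_field c v)"
  have const: "dir_deriv A (coord_field c u) (dir_deriv A (coord_field c v) (\<lambda>x. snd c x $ i)) x = 0" for u v i
  proof -
    have "dir_deriv A (coord_field c u) (dir_deriv A (coord_field c v) (\<lambda>x. snd c x $ i)) x =
        dir_deriv A (coord_field c u) (\<lambda>x. v $ i) x"
      using c by (intro dir_deriv_cong[OF chart_open])
        (auto simp: dir_deriv_coordinate components_coord_field)
    thus ?thesis by (simp add: dir_deriv_const)
  qed
  have "components A c x (?L x) $ i = 0" for i
    using lie_bracket_commutator[OF chart_open[OF c(1)] c(2) smooth_field_coord_field smooth_field_coord_field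
        smooth_fun_coordinate, OF c(1) c(1) c(1), of u v i]
    by (simp add: const dir_deriv_coordinate[OF c])
  hence "components A c x (?L x) = 0" by (simp add: vec_eq_iff)
  thus ?thesis
    using coord_field_components[OF c, of "?L x"] linear_0[OF coord_field_linear[OF c]] by simp
qed

end


section \<open>The Levi-Civita connection and its curvature\<close>

locale riemannian = smooth_atlas M A
  for M :: "'a topology" and A :: "('a, 'n::finite) chart set" +
  fixes g :: "'a \<Rightarrow> real ^ 'n \<Rightarrow> real ^ 'n \<Rightarrow> real" and nabla :: "('a, 'n) conn"
  assumes metric: "riemannian_metric M A g"
    and levi_civita: "levi_civita M A g nabla"
begin

lemma g_bilinear: "x \<in> topspace M \<Longrightarrow> bilinear (g x)"
  using metric by (simp add: riemannian_metric_def)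

lemma g_sym: "x \<in> topspace M \<Longrightarrow> g x v w = g x w v"
  using metric unfolding riemannian_metric_def by blast

lemma g_pos: "x \<in> topspace M \<Longrightarrow> v \<noteq> 0 \<Longrightarrow> g x v v > 0"
  using metric unfolding riemannian_metric_def by blast

lemma g_eq_0: "x \<in> topspace M \<Longrightarrow> g x v v = 0 \<Longrightarrow> v = 0"
  using g_pos by force

lemma g_smooth:
  "openin M W \<Longrightarrow> smooth_field A W X \<Longrightarrow> smooth_field A W Y \<Longrightarrow> smooth_fun A W (\<lambda>x. g x (X x) (Y x))"
  using metric unfolding riemannian_metric_def by blast

lemmas g_simps = bilinear_ladd[OF g_bilinear] bilinear_radd[OF g_bilinear]
  bilinear_lmul[OF g_bilinear] bilinear_rmul[OF g_bilinear]
  bilinear_lsub[OF g_bilinear] bilinear_rsub[OF g_bilinear]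
  bilinear_lneg[OF g_bilinear] bilinear_rneg[OF g_bilinear]
  bilinear_lzero[OF g_bilinear] bilinear_rzero[OF g_bilinear]

lemma connection: "connection M A nabla"
  using levi_civita by (simp add: levi_civita_def)

lemma torsion_free:
  assumes "openin M W" "x \<in> W" "smooth_field A W X" "smooth_field A W Y"
  shows "lie_bracket A X Y x = nabla X Y x - nabla Y X x"
proof -
  have "\<forall>W X Y. openin M W \<and> smooth_field A W X \<and> smooth_field A W Y \<longrightarrow>
      (\<forall>x\<in>W. nabla X Y x - nabla Y X x = lie_bracket A X Y x)"
    using levi_civita by (simp add: levi_civita_def)
  hence "nabla X Y x - nabla Y X x = lie_bracket A X Y x"
    using assms by blast
  thus ?thesis by simp
qed

lemma metric_compatible:
  assumes "openin M W" "x \<in> W" "smooth_field A W X" "smooth_field A W Y" "smooth_field A W Z"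
  shows "dir_deriv A X (\<lambda>y. g y (Y y) (Z y)) x = g x (nabla X Y x) (Z x) + g x (Y x) (nabla X Z x)"
proof -
  have "\<forall>W X Y Z. openin M W \<and> smooth_field A W X \<and> smooth_field A W Y \<and> smooth_field A W Z \<longrightarrow>
      (\<forall>x\<in>W. dir_deriv A X (\<lambda>y. g y (Y y) (Z y)) x = g x (nabla X Y x) (Z x) + g x (Y x) (nabla X Z x))"
    using levi_civita by (simp add: levi_civita_def)
  thus ?thesis using assms by blast
qed

lemma nabla_smooth:
  assumes W: "openin M W" and X: "smooth_field A W X" "smooth_field A W Y"
  shows "smooth_field A W (nabla X Y)"
  using connection[unfolded connection_def, rule_format, OF conjI[OF W], OF conjI[OF X(1)],
      OF conjI[OF X(2)], OF conjI[OF X(1) smooth_fun_const[of W 0]]] by (rule conjunct1)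

lemma lie_bracket_smooth:
  assumes W: "openin M W" and X: "smooth_field A W X" "smooth_field A W Y"
  shows "smooth_field A W (lie_bracket A X Y)"
  by (rule smooth_field_cong[OF W _ smooth_field_diff[OF W nabla_smooth[OF W X] nabla_smooth[OF W X(2,1)]]])
     (simp add: torsion_free[OF W _ X])

context
  fixes W x
  assumes W: "openin M W" "x \<in> W"
begin

lemma in_topspace: "x \<in> topspace M"
  using W openin_subset by blast

lemma connection_rules:
  assumes "smooth_field A W X" "smooth_field A W Y" "smooth_field A W Z" "smooth_fun A W f"
  shows "nabla (\<lambda>y. X y + Z y) Y x = nabla X Y x + nabla Z Y x"
    "nabla (\<lambda>y. f y *\<^sub>R X y) Y x = f x *\<^sub>R nabla X Y x"
    "nabla X (\<lambda>y. Y y + Z y) x = nabla X Y x + nabla X Z x"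
    "nabla X (\<lambda>y. f y *\<^sub>R Y y) x = dir_deriv A X f x *\<^sub>R Y x + f x *\<^sub>R nabla X Y x"
proof -
  note rules = connection[unfolded connection_def, rule_format, OF conjI[OF W(1)],
      OF conjI[OF assms(1)], OF conjI[OF assms(2)], OF conjI[OF assms(3,4)]]
  show "nabla (\<lambda>y. X y + Z y) Y x = nabla X Y x + nabla Z Y x"
    "nabla (\<lambda>y. f y *\<^sub>R X y) Y x = f x *\<^sub>R nabla X Y x"
    "nabla X (\<lambda>y. Y y + Z y) x = nabla X Y x + nabla X Z x"
    "nabla X (\<lambda>y. f y *\<^sub>R Y y) x = dir_deriv A X f x *\<^sub>R Y x + f x *\<^sub>R nabla X Y x"
    using rules[THEN conjunct2, rule_format, OF W(2)] by simp_all
qed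

lemma nabla_add_left:
  "smooth_field A W X \<Longrightarrow> smooth_field A W Z \<Longrightarrow> smooth_field A W Y \<Longrightarrow>
    nabla (\<lambda>y. X y + Z y) Y x = nabla X Y x + nabla Z Y x"
  using connection_rules(1) smooth_fun_const by blast

lemma nabla_add_right:
  "smooth_field A W X \<Longrightarrow> smooth_field A W Y \<Longrightarrow> smooth_field A W Z \<Longrightarrow>
    nabla X (\<lambda>y. Y y + Z y) x = nabla X Y x + nabla X Z x"
  using connection_rules(3) smooth_fun_const by blast

lemma nabla_scale_left:
  "smooth_fun A W f \<Longrightarrow> smooth_field A W X \<Longrightarrow> smooth_field A W Y \<Longrightarrow>
    nabla (\<lambda>y. f y *\<^sub>R X y) Y x = f x *\<^sub>R nabla X Y x"
  using connection_rules(2) by blast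

lemma nabla_leibniz:
  "smooth_fun A W f \<Longrightarrow> smooth_field A W X \<Longrightarrow> smooth_field A W Y \<Longrightarrow>
    nabla X (\<lambda>y. f y *\<^sub>R Y y) x = dir_deriv A X f x *\<^sub>R Y x + f x *\<^sub>R nabla X Y x"
  using connection_rules(4) by blast

text \<open>A field vanishing on \<open>W\<close> is its own product with the indicator of the complement of \<open>W\<close>,
  a function that is smooth on \<open>W\<close>.\<close>

lemma nabla_zero_left:
  assumes X: "\<And>y. y \<in> W \<Longrightarrow> X y = 0" and Y: "smooth_field A W Y"
  shows "nabla X Y x = 0"
proof -
  define f :: "'a \<Rightarrow> real" where "f y = (if y \<in> W then 0 else 1)" for y
  have f: "smooth_fun A W f"
    by (rule smooth_fun_cong[OF W(1) _ smooth_fun_const[of _ 0]]) (simp add: f_def)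
  have "smooth_field A W X"
    by (rule smooth_field_cong[OF W(1) _ smooth_field_zero[OF W(1)]]) (simp add: X)
  from nabla_scale_left[OF f this Y] have "nabla (\<lambda>y. f y *\<^sub>R X y) Y x = 0"
    using W by (simp add: f_def)
  moreover have "(\<lambda>y. f y *\<^sub>R X y) = X" using X by (auto simp: f_def)
  ultimately show ?thesis by simp
qed

lemma nabla_zero_right:
  assumes X: "smooth_field A W X" and Y: "\<And>y. y \<in> W \<Longrightarrow> Y y = 0"
  shows "nabla X Y x = 0"
proof -
  define f :: "'a \<Rightarrow> real" where "f y = (if y \<in> W then 0 else 1)" for y
  have f: "smooth_fun A W f"
    by (rule smooth_fun_cong[OF W(1) _ smooth_fun_const[of _ 0]]) (simp add: f_def)
  have "smooth_field A W Y"
    by (rule smooth_field_cong[OF W(1) _ smooth_field_zero[OF W(1)]]) (simp add: Y)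
  from nabla_leibniz[OF f X this] have "nabla X (\<lambda>y. f y *\<^sub>R Y y) x = 0"
    using W Y by (simp add: f_def)
  moreover have "(\<lambda>y. f y *\<^sub>R Y y) = Y" using Y by (auto simp: f_def)
  ultimately show ?thesis by simp
qed

lemma nabla_cong_left:
  assumes X: "smooth_field A W X" and Y: "smooth_field A W Y" and eq: "\<And>y. y \<in> W \<Longrightarrow> X y = X' y"
  shows "nabla X' Y x = nabla X Y x"
proof -
  have X': "smooth_field A W X'" by (rule smooth_field_cong[OF W(1) eq X])
  have "nabla (\<lambda>y. X y + (X' y - X y)) Y x = nabla X Y x + nabla (\<lambda>y. X' y - X y) Y x"
    using X X' Y by (intro nabla_add_left smooth_field_diff W(1))
  moreover have "nabla (\<lambda>y. X' y - X y) Y x = 0"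
    using eq by (intro nabla_zero_left Y) simp
  ultimately show ?thesis by simp
qed

lemma nabla_cong_right:
  assumes X: "smooth_field A W X" and Y: "smooth_field A W Y" and eq: "\<And>y. y \<in> W \<Longrightarrow> Y y = Y' y"
  shows "nabla X Y' x = nabla X Y x"
proof -
  have Y': "smooth_field A W Y'" by (rule smooth_field_cong[OF W(1) eq Y])
  have "nabla X (\<lambda>y. Y y + (Y' y - Y y)) x = nabla X Y x + nabla X (\<lambda>y. Y' y - Y y) x"
    using X Y' Y by (intro nabla_add_right smooth_field_diff W(1))
  moreover have "nabla X (\<lambda>y. Y' y - Y y) x = 0"
    using eq by (intro nabla_zero_right X) simp
  ultimately show ?thesis by simp
qed

lemma nabla_sum_left:
  assumes "finite I" "\<And>i. i \<in> I \<Longrightarrow> smooth_fun A W (f i)" "\<And>i. i \<in> I \<Longrightarrow> smooth_field A W (E i)"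
    and Y: "smooth_field A W Y"
  shows "nabla (\<lambda>y. \<Sum>i\<in>I. f i y *\<^sub>R E i y) Y x = (\<Sum>i\<in>I. f i x *\<^sub>R nabla (E i) Y x)"
  using assms(1,2,3)
proof (induction I rule: finite_induct)
  case empty
  show ?case using nabla_zero_left[OF _ Y] by simp
next
  case (insert i I)
  have s: "smooth_field A W (\<lambda>y. f i y *\<^sub>R E i y)" "smooth_field A W (\<lambda>y. \<Sum>i\<in>I. f i y *\<^sub>R E i y)"
    using insert.prems by (auto intro!: smooth_field_sum smooth_field_scale W(1))
  show ?case
    using nabla_add_left[OF s Y] nabla_scale_left[of "f i" "E i" Y] insert Y by simp
qed

lemma nabla_sum_right:
  assumes "finite I" "\<And>i. i \<in> I \<Longrightarrow> smooth_fun A W (f i)" "\<And>i. i \<in> I \<Longrightarrow> smooth_field A W (E i)"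
    and X: "smooth_field A W X"
  shows "nabla X (\<lambda>y. \<Sum>i\<in>I. f i y *\<^sub>R E i y) x =
    (\<Sum>i\<in>I. dir_deriv A X (f i) x *\<^sub>R E i x + f i x *\<^sub>R nabla X (E i) x)"
  using assms(1,2,3)
proof (induction I rule: finite_induct)
  case empty
  show ?case using nabla_zero_right[OF X] by simp
next
  case (insert i I)
  have s: "smooth_field A W (\<lambda>y. f i y *\<^sub>R E i y)" "smooth_field A W (\<lambda>y. \<Sum>i\<in>I. f i y *\<^sub>R E i y)"
    using insert.prems by (auto intro!: smooth_field_sum smooth_field_scale W(1))
  show ?case
    using nabla_add_right[OF X s] nabla_leibniz[of "f i" X "E i"] insert X by simp
qed

end

text \<open>The coordinate fields of the chart at \<open>x\<close> form a smooth frame near \<open>x\<close>.\<close>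

lemma local_frame:
  assumes W: "openin M W" "x \<in> W" and X: "smooth_field A W X"
  obtains V and E :: "'n \<Rightarrow> 'a \<Rightarrow> real ^ 'n" and f :: "'n \<Rightarrow> 'a \<Rightarrow> real"
  where "openin M V" "x \<in> V" "V \<subseteq> W" "\<And>i. smooth_field A V (E i)" "\<And>i. smooth_fun A V (f i)"
    "\<And>y. y \<in> V \<Longrightarrow> X y = (\<Sum>i\<in>UNIV. f i y *\<^sub>R E i y)" "X x = 0 \<Longrightarrow> \<forall>i. f i x = 0"
proof -
  define c where "c = chart_at A x"
  have c: "c \<in> A" "x \<in> fst c" using chart_at[OF in_topspace[OF W]] by (auto simp: c_def)
  have V: "openin M (W \<inter> fst c)" using W chart_open[OF c(1)] by auto
  show ?thesis
  proof (rule that[OF V])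
    show "smooth_field A (W \<inter> fst c) (coord_field c (axis i 1))" for i
      by (rule smooth_field_subset[OF smooth_field_coord_field[OF c(1)]]) auto
    show "smooth_fun A (W \<inter> fst c) (\<lambda>y. components A c y (X y) $ i)" for i
      by (rule smooth_fun_component[OF V c(1) _ smooth_field_subset[OF X]]) auto
    show "X y = (\<Sum>i\<in>UNIV. (components A c y (X y) $ i) *\<^sub>R coord_field c (axis i 1) y)"
      if "y \<in> W \<inter> fst c" for y using that by (intro coord_field_expansion c(1)) auto
    show "\<forall>i. components A c x (X x) $ i = 0" if "X x = 0"
      using that linear_0[OF components_linear[OF c]] by simp
  qed (use W c in auto)
qed

text \<open>Linearity over functions makes \<open>nabla X Y x\<close> depend only on the value of \<open>X\<close> at \<open>x\<close>.\<close>

lemma nabla_vanish_left: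
  assumes W: "openin M W" "x \<in> W" and X: "smooth_field A W X" "X x = 0" and Y: "smooth_field A W Y"
  shows "nabla X Y x = 0"
proof -
  obtain V E f where V: "openin M V" "x \<in> V" "V \<subseteq> W"
    and E: "\<And>i::'n. smooth_field A V (E i)" "\<And>i. smooth_fun A V (f i)"
    and eq: "\<And>y. y \<in> V \<Longrightarrow> X y = (\<Sum>i\<in>UNIV. f i y *\<^sub>R E i y)" "X x = 0 \<Longrightarrow> \<forall>i. f i x = 0"
    by (rule local_frame[OF W X(1)], rule that) blast+
  have s: "smooth_field A V X" "smooth_field A V Y" using X Y V smooth_field_subset by blast+
  have "nabla X Y x = nabla (\<lambda>y. \<Sum>i\<in>UNIV. f i y *\<^sub>R E i y) Y x"
    using nabla_cong_left[OF V(1,2) s eq(1)] by simp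
  also have "\<dots> = 0" using nabla_sum_left[where I = UNIV and f = f and E = E, OF V(1,2) _ E(2,1) s(2)] eq(2) X by simp
  finally show ?thesis .
qed

lemma nabla_point_left:
  assumes W: "openin M W" "x \<in> W" and X: "smooth_field A W X" and X': "smooth_field A W X'" "X x = X' x"
    and Y: "smooth_field A W Y"
  shows "nabla X Y x = nabla X' Y x"
proof -
  have "nabla (\<lambda>y. X y + (X' y - X y)) Y x = nabla X Y x + nabla (\<lambda>y. X' y - X y) Y x"
    using X X' Y by (intro nabla_add_left[OF W] smooth_field_diff[OF W(1)])
  moreover have "nabla (\<lambda>y. X' y - X y) Y x = 0"
    using X X' by (intro nabla_vanish_left[OF W _ _ Y] smooth_field_diff[OF W(1)]) auto
  ultimately show ?thesis by simp
qed


subsection \<open>Curvature is a tensor\<close>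

lemma curvature_swap:
  assumes W: "openin M W" "x \<in> W"
    and X: "smooth_field A W X" and Y: "smooth_field A W Y" and Z: "smooth_field A W Z"
  shows "curvature A nabla Y X Z x = - curvature A nabla X Y Z x"
proof -
  note L = lie_bracket_smooth[OF W(1) X Y]
  have "lie_bracket A Y X = (\<lambda>y. -1 *\<^sub>R lie_bracket A X Y y)"
    by (rule ext) (simp add: lie_bracket_def Let_def)
  hence "nabla (lie_bracket A Y X) Z x = - nabla (lie_bracket A X Y) Z x"
    using nabla_scale_left[OF W smooth_fun_const[of _ "-1"] L Z] by simp
  thus ?thesis by (simp add: curvature_def)
qed

lemma curvature_add_1:
  assumes W: "openin M W" "x \<in> W"
    and X: "smooth_field A W X" "smooth_field A W X'"
    and Y: "smooth_field A W Y" and Z: "smooth_field A W Z"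
  shows "curvature A nabla (\<lambda>y. X y + X' y) Y Z x = curvature A nabla X Y Z x + curvature A nabla X' Y Z x"
proof -
  note s = smooth_field_add[OF W(1) X]
  note n = nabla_smooth[OF W(1)]
  have "lie_bracket A (\<lambda>y. X y + X' y) Y x = lie_bracket A X Y x + lie_bracket A X' Y x"
    using torsion_free[OF W] nabla_add_left[OF W X Y] nabla_add_right[OF W Y X] X Y s
    by simp
  hence "nabla (lie_bracket A (\<lambda>y. X y + X' y) Y) Z x =
      nabla (\<lambda>y. lie_bracket A X Y y + lie_bracket A X' Y y) Z x"
    using X Y Z s by (intro nabla_point_left[OF W] smooth_field_add[OF W(1)] lie_bracket_smooth[OF W(1)])
  also have "\<dots> = nabla (lie_bracket A X Y) Z x + nabla (lie_bracket A X' Y) Z x"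
    using X Y Z by (intro nabla_add_left[OF W] lie_bracket_smooth[OF W(1)])
  finally have 1: "nabla (lie_bracket A (\<lambda>y. X y + X' y) Y) Z x =
    nabla (lie_bracket A X Y) Z x + nabla (lie_bracket A X' Y) Z x" .
  have "nabla Y (nabla (\<lambda>y. X y + X' y) Z) x = nabla Y (\<lambda>y. nabla X Z y + nabla X' Z y) x"
    using nabla_add_left[OF W(1) _ X Z]
    by (intro nabla_cong_right[OF W Y] smooth_field_add[OF W(1)] n X Z) simp
  also have "\<dots> = nabla Y (nabla X Z) x + nabla Y (nabla X' Z) x"
    by (intro nabla_add_right[OF W] n X Y Z)
  finally show ?thesis
    using nabla_add_left[OF W X n[OF Y Z]] by (simp add: curvature_def 1)
qed

lemma curvature_add_3:
  assumes W: "openin M W" "x \<in> W"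
    and X: "smooth_field A W X" and Y: "smooth_field A W Y"
    and Z: "smooth_field A W Z" "smooth_field A W Z'"
  shows "curvature A nabla X Y (\<lambda>y. Z y + Z' y) x = curvature A nabla X Y Z x + curvature A nabla X Y Z' x"
proof -
  note n = nabla_smooth[OF W(1)]
  have 1: "nabla X (nabla Y (\<lambda>y. Z y + Z' y)) x = nabla X (nabla Y Z) x + nabla X (nabla Y Z') x"
    if X: "smooth_field A W X" and Y: "smooth_field A W Y" for X Y
  proof -
    have "nabla X (nabla Y (\<lambda>y. Z y + Z' y)) x = nabla X (\<lambda>y. nabla Y Z y + nabla Y Z' y) x"
      using nabla_add_right[OF W(1) _ Y Z]
      by (intro nabla_cong_right[OF W X] smooth_field_add[OF W(1)] n Y Z) simp
    also have "\<dots> = nabla X (nabla Y Z) x + nabla X (nabla Y Z') x"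
      by (intro nabla_add_right[OF W] n X Y Z)
    finally show ?thesis .
  qed
  show ?thesis
    using nabla_add_right[OF W lie_bracket_smooth[OF W(1) X Y] Z] by (simp add: curvature_def 1 X Y)
qed

lemma curvature_scale_3:
  assumes W: "openin M W" "x \<in> W"
    and X: "smooth_field A W X" and Y: "smooth_field A W Y" and Z: "smooth_field A W Z"
  shows "curvature A nabla X Y (\<lambda>y. k *\<^sub>R Z y) x = k *\<^sub>R curvature A nabla X Y Z x"
proof -
  note n = nabla_smooth[OF W(1)]
  have c: "nabla X (\<lambda>y. k *\<^sub>R Z y) y = k *\<^sub>R nabla X Z y"
    if "y \<in> W" "smooth_field A W X" "smooth_field A W Z" for X Z y
    using nabla_leibniz[OF W(1) that(1) smooth_fun_const[of _ k] that(2,3)] by (simp add: dir_deriv_const)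
  have 1: "nabla X (nabla Y (\<lambda>y. k *\<^sub>R Z y)) x = k *\<^sub>R nabla X (nabla Y Z) x"
    if X: "smooth_field A W X" and Y: "smooth_field A W Y" for X Y
  proof -
    have "nabla X (nabla Y (\<lambda>y. k *\<^sub>R Z y)) x = nabla X (\<lambda>y. k *\<^sub>R nabla Y Z y) x"
      using c[OF _ Y Z]
      by (intro nabla_cong_right[OF W X] smooth_field_scale[OF W(1) smooth_fun_const] n Y Z) simp
    also have "\<dots> = k *\<^sub>R nabla X (nabla Y Z) x"
      by (intro c W X n Y Z)
    finally show ?thesis .
  qed
  show ?thesis
    using c[OF W(2) lie_bracket_smooth[OF W(1) X Y] Z] by (simp add: curvature_def 1 X Y algebra_simps)
qed

lemma curvature_scale_1:
  assumes W: "openin M W" "x \<in> W"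
    and X: "smooth_field A W X" and Y: "smooth_field A W Y" and Z: "smooth_field A W Z"
  shows "curvature A nabla (\<lambda>y. k *\<^sub>R X y) Y Z x = k *\<^sub>R curvature A nabla X Y Z x"
proof -
  note n = nabla_smooth[OF W(1)]
  note s = smooth_field_scale[OF W(1) smooth_fun_const[of _ k]]
  have r: "nabla X (\<lambda>y. k *\<^sub>R Z y) x = k *\<^sub>R nabla X Z x"
    if "smooth_field A W X" "smooth_field A W Z" for X Z
    using nabla_leibniz[OF W smooth_fun_const[of _ k] that] by (simp add: dir_deriv_const)
  have l: "nabla (\<lambda>y. k *\<^sub>R X y) Z y = k *\<^sub>R nabla X Z y"
    if "y \<in> W" "smooth_field A W X" "smooth_field A W Z" for X Z y
    using nabla_scale_left[OF W(1) that(1) smooth_fun_const[of _ k] that(2,3)] by simp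
  have "lie_bracket A (\<lambda>y. k *\<^sub>R X y) Y x = k *\<^sub>R lie_bracket A X Y x"
    using torsion_free[OF W s[OF X] Y] torsion_free[OF W X Y] l[OF W(2) X Y] r[OF Y X]
    by (simp add: scaleR_diff_right)
  hence "nabla (lie_bracket A (\<lambda>y. k *\<^sub>R X y) Y) Z x = nabla (\<lambda>y. k *\<^sub>R lie_bracket A X Y y) Z x"
    by (intro nabla_point_left[OF W _ s] lie_bracket_smooth[OF W(1)] s X Y Z)
  hence 1: "nabla (lie_bracket A (\<lambda>y. k *\<^sub>R X y) Y) Z x = k *\<^sub>R nabla (lie_bracket A X Y) Z x"
    using l[OF W(2) lie_bracket_smooth[OF W(1) X Y] Z] by simp
  have "nabla Y (nabla (\<lambda>y. k *\<^sub>R X y) Z) x = nabla Y (\<lambda>y. k *\<^sub>R nabla X Z y) x"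
    using l[OF _ X Z] by (intro nabla_cong_right[OF W Y] s n X Z) simp
  hence 2: "nabla Y (nabla (\<lambda>y. k *\<^sub>R X y) Z) x = k *\<^sub>R nabla Y (nabla X Z) x"
    using r[OF Y n[OF X Z]] by simp
  show ?thesis
    using l[OF W(2) X n[OF Y Z]] by (simp add: curvature_def 1 2 algebra_simps)
qed

text \<open>If \<open>X = \<Sum> f\<^sub>i E\<^sub>i\<close> with all \<open>f\<^sub>i\<close> zero at \<open>x\<close>, then \<open>\<nabla>\<^sub>Y \<nabla>\<^sub>X Z\<close> and \<open>\<nabla>\<^bsub>[X, Y]\<^esub> Z\<close> at \<open>x\<close> are
  \<open>\<Sum> Y(f\<^sub>i) \<nabla>\<^bsub>E\<^sub>i\<^esub> Z\<close> and its negative.\<close>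

lemma curvature_vanish_1:
  assumes W: "openin M W" "x \<in> W" and X: "smooth_field A W X" "X x = 0"
    and Y: "smooth_field A W Y" and Z: "smooth_field A W Z"
  shows "curvature A nabla X Y Z x = 0"
proof -
  obtain V E f where V: "openin M V" "x \<in> V" "V \<subseteq> W"
    and E: "\<And>i::'n. smooth_field A V (E i)" "\<And>i. smooth_fun A V (f i)"
    and eq: "\<And>y. y \<in> V \<Longrightarrow> X y = (\<Sum>i\<in>UNIV. f i y *\<^sub>R E i y)" "X x = 0 \<Longrightarrow> \<forall>i. f i x = 0"
    by (rule local_frame[OF W X(1)], rule that) blast+
  note o = V(1,2)
  have s: "smooth_field A V X" "smooth_field A V Y" "smooth_field A V Z"
    using X Y Z V smooth_field_subset by blast+
  note n = nabla_smooth[OF o(1)]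
  have XZ: "nabla X Z y = (\<Sum>i\<in>UNIV. f i y *\<^sub>R nabla (E i) Z y)" if "y \<in> V" for y
    using nabla_cong_left[OF V(1) that s(1,3) eq(1)] nabla_sum_left[where I = UNIV and f = f and E = E, OF V(1) that _ E(2,1) s(3)] by simp
  have 1: "nabla X (nabla Y Z) x = 0"
    using s X by (intro nabla_vanish_left[OF o] n)
  have "nabla Y (nabla X Z) x = nabla Y (\<lambda>y. \<Sum>i\<in>UNIV. f i y *\<^sub>R nabla (E i) Z y) x"
    using nabla_cong_right[OF o s(2) n[OF s(1,3)] XZ] by simp
  hence 2: "nabla Y (nabla X Z) x = (\<Sum>i\<in>UNIV. dir_deriv A Y (f i) x *\<^sub>R nabla (E i) Z x)"
    using nabla_sum_right[where I = UNIV and f = f and E = "\<lambda>i. nabla (E i) Z", OF o _ E(2) n[OF E(1) s(3)] s(2)] eq(2) X by simp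
  have "nabla Y X x = nabla Y (\<lambda>y. \<Sum>i\<in>UNIV. f i y *\<^sub>R E i y) x"
    using nabla_cong_right[OF o s(2,1) eq(1)] by simp
  hence "nabla Y X x = (\<Sum>i\<in>UNIV. dir_deriv A Y (f i) x *\<^sub>R E i x)"
    using nabla_sum_right[where I = UNIV and f = f and E = E, OF o _ E(2,1) s(2)] eq(2) X by simp
  hence "lie_bracket A X Y x = (\<Sum>i\<in>UNIV. (- dir_deriv A Y (f i) x) *\<^sub>R E i x)"
    using torsion_free[OF o s(1,2)] nabla_vanish_left[OF o s(1) X(2) s(2)] by (simp add: sum_negf)
  hence "nabla (lie_bracket A X Y) Z x = nabla (\<lambda>y. \<Sum>i\<in>UNIV. (- dir_deriv A Y (f i) x) *\<^sub>R E i y) Z x"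
    using s E by (intro nabla_point_left[OF o] lie_bracket_smooth[OF o(1)] smooth_field_sum[OF V(1)]
        smooth_field_scale[OF V(1)] smooth_fun_const)
  hence "nabla (lie_bracket A X Y) Z x = (\<Sum>i\<in>UNIV. (- dir_deriv A Y (f i) x) *\<^sub>R nabla (E i) Z x)"
    using nabla_sum_left[where I = UNIV and f = "\<lambda>i y. - dir_deriv A Y (f i) x" and E = E,
        OF o _ smooth_fun_const E(1) s(3)] by simp
  thus ?thesis by (simp add: curvature_def 1 2 sum_negf)
qed

text \<open>Differentiate \<open>g(Z, V)\<close> twice, antisymmetrize, and compare with its derivative along \<open>[X, Y]\<close>.\<close>

lemma curvature_metric:
  assumes W: "openin M W" "x \<in> W" and X: "smooth_field A W X" and Y: "smooth_field A W Y"
    and Z: "smooth_field A W Z" and V: "smooth_field A W V"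
  shows "g x (curvature A nabla X Y Z x) (V x) = - g x (Z x) (curvature A nabla X Y V x)"
proof -
  note n = nabla_smooth[OF W(1)]
  have iter: "dir_deriv A X (dir_deriv A Y (\<lambda>y. g y (Z y) (V y))) x =
      g x (nabla X (nabla Y Z) x) (V x) + g x (nabla Y Z x) (nabla X V x)
      + g x (nabla X Z x) (nabla Y V x) + g x (Z x) (nabla X (nabla Y V) x)"
    if X: "smooth_field A W X" and Y: "smooth_field A W Y" for X Y
  proof -
    have "dir_deriv A X (dir_deriv A Y (\<lambda>y. g y (Z y) (V y))) x =
        dir_deriv A X (\<lambda>y. g y (nabla Y Z y) (V y) + g y (Z y) (nabla Y V y)) x"
      by (intro dir_deriv_cong[OF W] metric_compatible[OF W(1)] Y Z V)
    also have "\<dots> = dir_deriv A X (\<lambda>y. g y (nabla Y Z y) (V y)) x + dir_deriv A X (\<lambda>y. g y (Z y) (nabla Y V y)) x"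
      by (intro dir_deriv_add[OF W] g_smooth[OF W(1)] n Y Z V)
    finally show ?thesis
      using metric_compatible[OF W X n[OF Y Z] V] metric_compatible[OF W X Z n[OF Y V]] by simp
  qed
  have "dir_deriv A (lie_bracket A X Y) (\<lambda>y. g y (Z y) (V y)) x =
      g x (nabla (lie_bracket A X Y) Z x) (V x) + g x (Z x) (nabla (lie_bracket A X Y) V x)"
    by (intro metric_compatible[OF W] lie_bracket_smooth[OF W(1)] X Y Z V)
  with lie_bracket_commutator[OF W X Y g_smooth[OF W(1) Z V]]
  show ?thesis
    unfolding iter[OF X Y] iter[OF Y X] by (simp add: curvature_def g_simps[OF in_topspace[OF W]])
qed

lemma extension:
  assumes x: "x \<in> topspace M"
  obtains W X where "openin M W" "x \<in> W" "smooth_field A W X" "X x = v"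
  using chart_at[OF x] chart_open[of "chart_at A x"] smooth_field_coord_field[of "chart_at A x" v]
    components_coord_field[of "chart_at A x" x v] components_self[OF x] by metis

text \<open>Skewness of the curvature moves it away from the vanishing field: pair \<open>R(X, Y)Z\<close> at \<open>x\<close>
  with a field that extends this very vector.\<close>

lemma curvature_vanish_3:
  assumes W: "openin M W" "x \<in> W" and X: "smooth_field A W X" and Y: "smooth_field A W Y"
    and Z: "smooth_field A W Z" "Z x = 0"
  shows "curvature A nabla X Y Z x = 0"
proof -
  obtain V U where V: "openin M V" "x \<in> V" "smooth_field A V U" "U x = curvature A nabla X Y Z x"
    using extension[OF in_topspace[OF W]] by metis
  have o: "openin M (V \<inter> W)" "x \<in> V \<inter> W" using V W by auto
  have "g x (curvature A nabla X Y Z x) (U x) = - g x (Z x) (curvature A nabla X Y U x)"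
    by (intro curvature_metric[OF o]) (use X Y Z V in \<open>auto intro: smooth_field_subset\<close>)
  thus ?thesis using V Z g_eq_0[OF in_topspace[OF W]] by (simp add: g_simps[OF in_topspace[OF W]])
qed

lemma curvature_pointwise:
  assumes W: "openin M W" "x \<in> W"
    and s: "smooth_field A W X" "smooth_field A W Y" "smooth_field A W Z"
    and s': "smooth_field A W X'" "smooth_field A W Y'" "smooth_field A W Z'"
    and eq: "X x = X' x" "Y x = Y' x" "Z x = Z' x"
  shows "curvature A nabla X Y Z x = curvature A nabla X' Y' Z' x"
proof -
  have 1: "curvature A nabla X Y Z x = curvature A nabla X' Y Z x"
    if "smooth_field A W X" "smooth_field A W Y" "smooth_field A W Z" "smooth_field A W X'" "X x = X' x"
    for X X' Y Z
  proof -
    have d: "smooth_field A W (\<lambda>y. X y - X' y)" by (intro smooth_field_diff[OF W(1)] that)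
    show ?thesis
      using curvature_add_1[OF W that(4) d that(2,3)] curvature_vanish_1[OF W d _ that(2,3)] that(5) by simp
  qed
  have "curvature A nabla X Y Z x = - curvature A nabla Y X' Z x"
    using 1[OF s s'(1) eq(1)] curvature_swap[OF W s'(1) s(2,3)] by simp
  also have "\<dots> = curvature A nabla X' Y' Z x"
    using 1[OF s(2) s'(1) s(3) s'(2) eq(2)] curvature_swap[OF W s'(1,2) s(3)] by simp
  also have "\<dots> = curvature A nabla X' Y' Z' x"
  proof -
    have d: "smooth_field A W (\<lambda>y. Z y - Z' y)" by (intro smooth_field_diff[OF W(1)] s s')
    show ?thesis
      using curvature_add_3[OF W s'(1,2,3) d] curvature_vanish_3[OF W s'(1,2) d] eq(3) by simp
  qed
  finally show ?thesis .
qed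

text \<open>The description of the curvature by extensions is consistent, so any convenient
  extension may be used.\<close>

lemma curvature_at_eq:
  assumes W: "openin M W" "x \<in> W"
    and s: "smooth_field A W X" "smooth_field A W Y" "smooth_field A W Z"
    and eq: "X x = u" "Y x = v" "Z x = w"
  shows "curvature_at M A nabla x u v w = curvature A nabla X Y Z x"
  unfolding curvature_at_def
proof (rule the_equality)
  show "\<exists>W' X' Y' Z'. openin M W' \<and> x \<in> W' \<and> smooth_field A W' X' \<and> smooth_field A W' Y' \<and>
      smooth_field A W' Z' \<and> X' x = u \<and> Y' x = v \<and> Z' x = w \<and>
      curvature A nabla X Y Z x = curvature A nabla X' Y' Z' x"
    using assms by blast
next
  fix r assume "\<exists>W X Y Z. openin M W \<and> x \<in> W \<and> smooth_field A W X \<and> smooth_field A W Y \<and>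
      smooth_field A W Z \<and> X x = u \<and> Y x = v \<and> Z x = w \<and> r = curvature A nabla X Y Z x"
  then obtain W' X' Y' Z' where W': "openin M W'" "x \<in> W'" "smooth_field A W' X'" "smooth_field A W' Y'"
    "smooth_field A W' Z'" "X' x = u" "Y' x = v" "Z' x = w" "r = curvature A nabla X' Y' Z' x" by blast
  have "openin M (W \<inter> W')" using W W' by auto
  thus "r = curvature A nabla X Y Z x" unfolding W'(9)
    by (rule curvature_pointwise) (use W W' s eq in \<open>auto intro: smooth_field_subset\<close>)
qed


subsection \<open>Algebraic symmetries of the curvature tensor\<close>

context
  fixes x assumes x: "x \<in> topspace M"
begin

abbreviation R :: "real ^ 'n \<Rightarrow> real ^ 'n \<Rightarrow> real ^ 'n \<Rightarrow> real ^ 'n" where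
  "R \<equiv> curvature_at M A nabla x"

abbreviation extend :: "real ^ 'n \<Rightarrow> 'a \<Rightarrow> real ^ 'n" where
  "extend \<equiv> coord_field (chart_at A x)"

abbreviation nbhd :: "'a set" where
  "nbhd \<equiv> fst (chart_at A x)"

lemma nbhd: "openin M nbhd" "x \<in> nbhd"
  using chart_at[OF x] chart_open[of "chart_at A x"] by auto

lemma extend: "smooth_field A nbhd (extend u)" "extend u x = u"
  using chart_at[OF x] smooth_field_coord_field components_coord_field[of "chart_at A x" x u] components_self[OF x]
  by auto

lemma R_extend: "R u v w = curvature A nabla (extend u) (extend v) (extend w) x"
  by (rule curvature_at_eq[OF nbhd]) (auto simp: extend)

lemma R_swap: "R v u w = - R u v w"
  unfolding R_extend using curvature_swap[OF nbhd] extend by blast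

lemma R_metric: "g x (R u v w) a = - g x w (R u v a)"
  using curvature_metric[OF nbhd extend(1) extend(1) extend(1) extend(1), of u v w a] extend(2)
  by (simp add: R_extend)

lemma R_linear_3: "linear (R u v)"
proof (rule linearI)
  fix w w' k
  have "R u v (w + w') = curvature A nabla (extend u) (extend v) (\<lambda>y. extend w y + extend w' y) x"
    by (rule curvature_at_eq[OF nbhd]) (auto simp: extend intro: smooth_field_add[OF nbhd(1)])
  also have "\<dots> = R u v w + R u v w'"
    unfolding R_extend by (intro curvature_add_3[OF nbhd] extend)
  finally show "R u v (w + w') = R u v w + R u v w'" .
  have "R u v (k *\<^sub>R w) = curvature A nabla (extend u) (extend v) (\<lambda>y. k *\<^sub>R extend w y) x"
    by (rule curvature_at_eq[OF nbhd]) (auto simp: extend intro: smooth_field_scale[OF nbhd(1) smooth_fun_const])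
  also have "\<dots> = k *\<^sub>R R u v w"
    unfolding R_extend by (intro curvature_scale_3[OF nbhd] extend)
  finally show "R u v (k *\<^sub>R w) = k *\<^sub>R R u v w" .
qed

lemma R_linear_2: "linear (\<lambda>v. R u v w)"
proof (rule linearI)
  fix v v' k
  have "R (v + v') u w = curvature A nabla (\<lambda>y. extend v y + extend v' y) (extend u) (extend w) x"
    by (rule curvature_at_eq[OF nbhd]) (auto simp: extend intro: smooth_field_add[OF nbhd(1)])
  also have "\<dots> = R v u w + R v' u w"
    unfolding R_extend by (intro curvature_add_1[OF nbhd] extend)
  finally show "R u (v + v') w = R u v w + R u v' w" unfolding R_swap[of u] by simp
  have "R (k *\<^sub>R v) u w = curvature A nabla (\<lambda>y. k *\<^sub>R extend v y) (extend u) (extend w) x"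
    by (rule curvature_at_eq[OF nbhd]) (auto simp: extend intro: smooth_field_scale[OF nbhd(1) smooth_fun_const])
  also have "\<dots> = k *\<^sub>R R v u w"
    unfolding R_extend by (intro curvature_scale_1[OF nbhd] extend)
  finally show "R u (k *\<^sub>R v) w = k *\<^sub>R R u v w" unfolding R_swap[of u] by simp
qed

text \<open>Coordinate fields commute, so \<open>\<nabla>\<^sub>U V = \<nabla>\<^sub>V U\<close> for them and the second covariant derivatives
  cancel in pairs.\<close>

lemma R_bianchi: "R u v w + R v w u + R w u v = 0"
proof -
  have c: "chart_at A x \<in> A" using chart_at[OF x] by simp
  have 0: "nabla (lie_bracket A (extend u) (extend v)) (extend w) x = 0" for u v w
    by (rule nabla_zero_left[OF nbhd]) (use c lie_bracket_coord_field extend in auto)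
  have "nabla (extend u) (extend v) y = nabla (extend v) (extend u) y" if "y \<in> nbhd" for u v y
    using torsion_free[OF nbhd(1) that extend(1) extend(1), of u v] lie_bracket_coord_field[OF c that, of u v]
    by simp
  hence "nabla (extend u) (nabla (extend v) (extend w)) x = nabla (extend u) (nabla (extend w) (extend v)) x"
    for u v w
    by (intro nabla_cong_right[OF nbhd] nabla_smooth[OF nbhd(1)] extend)
  note this[of u v w] this[of v w u] this[of w u v]
  thus ?thesis unfolding R_extend curvature_def 0 by simp
qed

lemma R_pair_symmetry: "g x (R a b c) d = g x (R c d a) b"
proof -
  define F where "F a b c d = g x (R a b c) d" for a b c d
  have 1: "F b a c d = - F a b c d" for a b c d
    using R_swap[of b a c] by (simp add: F_def g_simps[OF x])
  have 2: "F a b d c = - F a b c d" for a b c d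
    using R_metric[of a b d c] g_sym[OF x] by (simp add: F_def)
  have 3: "F a b c d + F b c a d + F c a b d = 0" for a b c d
    using R_bianchi[of a b c] by (simp add: F_def g_simps[OF x] flip: bilinear_ladd[OF g_bilinear[OF x]])
  \<comment> \<open>Add the four Bianchi identities obtained by omitting one of the four vectors in turn.\<close>
  have "F a b c d = F c d a b"
    using 3[of a b c d] 3[of b c d a] 3[of c d a b] 3[of d a b c]
      1[of b d c a] 1[of a d c b] 1[of c a d b] 1[of a d b c]
      2[of b c a d] 2[of c d a b] 2[of b d a c] 2[of a d b c] 2[of c a b d] 2[of a b c d]
    by linarith
  thus ?thesis by (simp add: F_def)
qed

end

end


section \<open>Orthonormal bases and the Ricci tensor\<close>

locale inner_form =
  fixes h :: "'v::euclidean_space \<Rightarrow> 'v \<Rightarrow> real"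
  assumes bil: "bilinear h" and sym: "h v w = h w v" and pos: "v \<noteq> 0 \<Longrightarrow> h v v > 0"
begin

definition orthonormal :: "'v set \<Rightarrow> bool" where
  "orthonormal B \<longleftrightarrow> (\<forall>a\<in>B. \<forall>b\<in>B. h a b = (if a = b then 1 else 0))"

lemmas h_simps = bilinear_ladd[OF bil] bilinear_radd[OF bil] bilinear_lmul[OF bil] bilinear_rmul[OF bil]
  bilinear_lsub[OF bil] bilinear_rsub[OF bil] bilinear_lzero[OF bil] bilinear_rzero[OF bil]

lemma h_linear: "linear (\<lambda>v. h v w)" "linear (h v)"
  using bil by (auto simp: bilinear_def)

lemma h_sum_left: "h (\<Sum>i\<in>I. k i *\<^sub>R f i) w = (\<Sum>i\<in>I. k i * h (f i) w)"
  using linear_sum[OF h_linear(1)[of w], of "\<lambda>i. k i *\<^sub>R f i" I] by (simp add: h_simps)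

lemma orthonormal_coefficient:
  assumes "orthonormal B" "finite T" "T \<subseteq> B" "b \<in> B"
  shows "h (\<Sum>a\<in>T. k a *\<^sub>R a) b = (if b \<in> T then k b else 0)"
proof -
  have "h (\<Sum>a\<in>T. k a *\<^sub>R a) b = (\<Sum>a\<in>T. if a = b then k a else 0)"
    unfolding h_sum_left using assms by (intro sum.cong) (auto simp: orthonormal_def)
  thus ?thesis using assms(2) by (simp add: sum.delta')
qed

lemma orthonormal_independent:
  assumes B: "orthonormal B" shows "independent B"
proof
  assume "dependent B"
  then obtain T u v where T: "finite T" "T \<subseteq> B" "(\<Sum>v\<in>T. u v *\<^sub>R v) = 0" "v \<in> T" "u v \<noteq> 0"
    unfolding dependent_explicit by blast
  thus False using orthonormal_coefficient[OF B T(1,2), of v u] by (auto simp: h_simps)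
qed

lemma orthonormal_finite: "orthonormal B \<Longrightarrow> finite B"
  using orthonormal_independent independent_bound by blast

text \<open>The difference of the two sides lies in the span of \<open>B\<close> and is orthogonal to \<open>B\<close>,
  hence to itself.\<close>

lemma orthonormal_expansion:
  assumes B: "orthonormal B" and v: "v \<in> span B"
  shows "v = (\<Sum>b\<in>B. h v b *\<^sub>R b)"
proof -
  define d where "d = v - (\<Sum>b\<in>B. h v b *\<^sub>R b)"
  have "h d b = 0" if "b \<in> B" for b
    using orthonormal_coefficient[OF B orthonormal_finite[OF B] order_refl that, of "h v"] that
    by (simp add: d_def h_simps)
  moreover have "d \<in> span B" unfolding d_def by (intro span_diff v span_sum span_scale span_base)
  ultimately have "h d d = 0"
    using span_induct[of d B "\<lambda>w. h d w = 0"] by (auto simp: subspace_def h_simps)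
  hence "d = 0" using pos by fastforce
  thus ?thesis by (simp add: d_def)
qed

text \<open>An orthonormal subset of \<open>T\<close> of maximal cardinality spans \<open>T\<close>, since otherwise a Gram-Schmidt step
  would enlarge it.\<close>

lemma orthonormal_basis_exists:
  assumes T: "subspace T"
  obtains B where "orthonormal B" "B \<subseteq> T" "span B = T"
proof -
  let ?P = "\<lambda>B. orthonormal B \<and> B \<subseteq> T"
  have "?P {}" by (simp add: orthonormal_def)
  moreover have "\<forall>B. ?P B \<longrightarrow> card B < Suc DIM('v)"
    using orthonormal_independent independent_bound by fastforce
  ultimately obtain B where B: "orthonormal B" "B \<subseteq> T" and max: "\<And>C. ?P C \<Longrightarrow> card C \<le> card B"
    using ex_has_greatest_nat[of ?P "{}" card] by metis
  have "v \<in> span B" if v: "v \<in> T" for v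
  proof (rule ccontr)
    assume no: "v \<notin> span B"
    define w where "w = v - (\<Sum>b\<in>B. h v b *\<^sub>R b)"
    define e where "e = (1 / sqrt (h w w)) *\<^sub>R w"
    have w0: "w \<noteq> 0"
      using no span_sum[of B "\<lambda>b. h v b *\<^sub>R b" B] by (auto simp: w_def span_scale span_base)
    have wT: "w \<in> T" unfolding w_def using B(2) by (intro subspace_diff subspace_sum subspace_scale T v) auto
    have wb: "h w b = 0" if "b \<in> B" for b
      using orthonormal_coefficient[OF B(1) orthonormal_finite[OF B(1)] order_refl that, of "h v"] that
      by (simp add: w_def h_simps)
    have eb: "h e b = 0" "h b e = 0" if "b \<in> B" for b
      using wb[OF that] sym[of b] by (auto simp: e_def h_simps)
    have ee: "h e e = 1" using pos[OF w0] by (simp add: e_def h_simps)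
    have "e \<notin> B" using eb ee by force
    hence "card (insert e B) = Suc (card B)" using orthonormal_finite[OF B(1)] by simp
    moreover have "orthonormal (insert e B)"
      using B(1) eb ee \<open>e \<notin> B\<close> by (auto simp: orthonormal_def)
    moreover have "insert e B \<subseteq> T" using B(2) wT T by (auto simp: e_def subspace_scale)
    ultimately show False using max[of "insert e B"] by simp
  qed
  moreover have "span B \<subseteq> T" by (rule span_minimal[OF B(2) T])
  ultimately show ?thesis using that B by blast
qed

text \<open>The matrix that expresses one orthonormal basis in the other is orthogonal, by Parseval's identity.\<close>

lemma trace_independent_of_basis:
  fixes Q :: "'v \<Rightarrow> 'v \<Rightarrow> real"
  assumes Q: "bilinear Q"
    and B: "orthonormal B" "span B = UNIV" and C: "orthonormal C" "span C = UNIV"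
  shows "(\<Sum>c\<in>C. Q c c) = (\<Sum>b\<in>B. Q b b)"
proof -
  have parseval: "h a b = (\<Sum>c\<in>C. h c a * h c b)" for a b
  proof -
    have "h a b = h (\<Sum>c\<in>C. h a c *\<^sub>R c) b" using orthonormal_expansion[OF C(1), of a] C(2) by simp
    thus ?thesis by (simp add: h_sum_left sym[of a])
  qed
  have expand: "Q v v = (\<Sum>a\<in>B. \<Sum>b\<in>B. h v a * h v b * Q a b)" for v
  proof -
    have L: "linear (\<lambda>v. Q v w)" "linear (Q w)" for w using Q by (auto simp: bilinear_def)
    have "Q v v = Q (\<Sum>a\<in>B. h v a *\<^sub>R a) (\<Sum>b\<in>B. h v b *\<^sub>R b)"
      using orthonormal_expansion[OF B(1), of v] B(2) by simp
    also have "\<dots> = (\<Sum>a\<in>B. h v a * Q a (\<Sum>b\<in>B. h v b *\<^sub>R b))"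
      by (subst linear_sum[OF L(1)]) (simp add: linear_cmul[OF L(1)])
    also have "\<dots> = (\<Sum>a\<in>B. h v a * (\<Sum>b\<in>B. h v b * Q a b))"
      by (simp add: linear_sum[OF L(2)] linear_cmul[OF L(2)])
    finally show ?thesis by (simp add: sum_distrib_left mult.assoc)
  qed
  have "(\<Sum>c\<in>C. Q c c) = (\<Sum>c\<in>C. \<Sum>a\<in>B. \<Sum>b\<in>B. h c a * h c b * Q a b)"
    by (rule sum.cong[OF refl expand])
  also have "\<dots> = (\<Sum>a\<in>B. \<Sum>b\<in>B. \<Sum>c\<in>C. h c a * h c b * Q a b)"
    by (subst sum.swap, rule sum.cong[OF refl], rule sum.swap)
  also have "\<dots> = (\<Sum>a\<in>B. \<Sum>b\<in>B. h a b * Q a b)"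
    by (simp only: sum_distrib_right[symmetric] parseval[symmetric])
  also have "\<dots> = (\<Sum>a\<in>B. \<Sum>b\<in>B. if a = b then Q a b else 0)"
    using B(1) by (intro sum.cong refl) (auto simp: orthonormal_def)
  also have "\<dots> = (\<Sum>b\<in>B. Q b b)"
    using orthonormal_finite[OF B(1)] by (simp add: sum.delta)
  finally show ?thesis .
qed

end

context riemannian
begin

lemma g_inner_form: "x \<in> topspace M \<Longrightarrow> inner_form (g x)"
  using g_bilinear g_sym g_pos by unfold_locales auto

abbreviation orthonormal_at :: "'a \<Rightarrow> (real ^ 'n) set \<Rightarrow> bool" where
  "orthonormal_at x \<equiv> inner_form.orthonormal (g x)"

lemma ricci_eq:
  assumes x: "x \<in> topspace M" and B: "orthonormal_at x B" "span B = UNIV"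
  shows "ricci M A g nabla x u v = (\<Sum>b\<in>B. g x (curvature_at M A nabla x u b b) v)"
proof -
  interpret inner_form "g x" by (rule g_inner_form[OF x])
  define Q where "Q a b = g x (curvature_at M A nabla x u a b) v" for a b
  have Q: "bilinear Q"
    unfolding bilinear_def Q_def
    using linear_compose[OF R_linear_2[OF x] h_linear(1)] linear_compose[OF R_linear_3[OF x] h_linear(1)]
    by (auto simp: o_def)
  have "card B = CARD('n)"
    using dim_span_eq_card_independent[OF orthonormal_independent[OF B(1)]] B(2) by simp
  then obtain e :: "'n \<Rightarrow> real ^ 'n" where e: "bij_betw e UNIV B"
    using finite_same_card_bij[of "UNIV :: 'n set" B] orthonormal_finite[OF B(1)] by auto
  show ?thesis
    unfolding ricci_def
  proof (rule the_equality)
    have "g x (e i) (e j) = (if i = j then 1 else 0)" for i j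
      using e B(1) by (auto simp: orthonormal_def bij_betw_def inj_def)
    moreover have "(\<Sum>b\<in>B. Q b b) = (\<Sum>i\<in>UNIV. Q (e i) (e i))"
      using sum.reindex_bij_betw[OF e, of "\<lambda>b. Q b b"] by simp
    ultimately show "\<exists>e :: 'n \<Rightarrow> real ^ 'n. (\<forall>i j. g x (e i) (e j) = (if i = j then 1 else 0)) \<and>
        (\<Sum>b\<in>B. g x (curvature_at M A nabla x u b b) v) =
        (\<Sum>i\<in>UNIV. g x (curvature_at M A nabla x u (e i) (e i)) v)"
      unfolding Q_def by blast
  next
    fix r assume "\<exists>e :: 'n \<Rightarrow> real ^ 'n. (\<forall>i j. g x (e i) (e j) = (if i = j then 1 else 0)) \<and>
        r = (\<Sum>i\<in>UNIV. g x (curvature_at M A nabla x u (e i) (e i)) v)"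
    then obtain e' :: "'n \<Rightarrow> real ^ 'n" where
      e': "\<And>i j. g x (e' i) (e' j) = (if i = j then 1 else 0)" and r: "r = (\<Sum>i\<in>UNIV. Q (e' i) (e' i))"
      unfolding Q_def by blast
    have inj: "inj e'" by (metis e' injI zero_neq_one)
    have on: "orthonormal (range e')" using e' by (auto simp: orthonormal_def inj_eq[OF inj])
    have "UNIV \<subseteq> span (range e')"
      by (rule card_ge_dim_independent[OF _ orthonormal_independent[OF on]]) (auto simp: card_image inj)
    hence "(\<Sum>c\<in>range e'. Q c c) = (\<Sum>b\<in>B. Q b b)"
      by (intro trace_independent_of_basis Q on B) auto
    thus "r = (\<Sum>b\<in>B. g x (curvature_at M A nabla x u b b) v)"
      by (simp add: r Q_def sum.reindex[OF inj])
  qed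
qed

text \<open>The dual vector exists because \<open>\<Sum> \<theta>(b) b\<close> over an orthonormal basis represents \<open>\<theta>\<close>; it is unique
  because \<open>g\<close> is nondegenerate.\<close>

lemma sharp_works:
  assumes x: "x \<in> topspace M" and L: "linear (\<theta> x)"
  shows "g x (sharp g \<theta> x) w = \<theta> x w"
proof -
  interpret inner_form "g x" by (rule g_inner_form[OF x])
  obtain B where B: "orthonormal B" "B \<subseteq> UNIV" "span B = UNIV"
    by (rule orthonormal_basis_exists[OF subspace_UNIV])
  define s where "s = (\<Sum>b\<in>B. \<theta> x b *\<^sub>R b)"
  have s: "g x s w = \<theta> x w" for w
  proof -
    have "\<theta> x w = \<theta> x (\<Sum>b\<in>B. g x w b *\<^sub>R b)" 
      by (rule arg_cong[OF orthonormal_expansion[OF B(1)]]) (simp add: B(3))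
    also have "\<dots> = (\<Sum>b\<in>B. g x w b * \<theta> x b)" by (simp add: linear_sum[OF L] linear_cmul[OF L])
    finally show ?thesis by (simp add: s_def h_sum_left sym[of w] mult.commute)
  qed
  have "\<forall>w. g x (sharp g \<theta> x) w = \<theta> x w"
    unfolding sharp_def
  proof (rule theI[of _ s])
    fix v assume "\<forall>w. g x v w = \<theta> x w"
    hence "g x (v - s) (v - s) = 0" using s by (simp add: h_simps)
    thus "v = s" using g_eq_0[OF x, of "v - s"] by simp
  qed (use s in simp)
  thus ?thesis by blast
qed

end


section \<open>Conformal product structures\<close>

text \<open>The assumptions single out \<open>T1\<close>, whose rank and local frames enter the trace over \<open>T1\<close>.  A second
  interpretation of the locale, with the two distributions exchanged, gives the statements about \<open>T2\<close>.\<close>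

locale adapted_weyl = riemannian M A g nabla
  for M :: "'a topology" and A :: "('a, 'n::finite) chart set" and g and nabla +
  fixes T1 T2 :: "'a \<Rightarrow> (real ^ 'n) set" and \<theta> :: "'a \<Rightarrow> real ^ 'n \<Rightarrow> real" and D :: "('a, 'n) conn"
    and p :: nat
  assumes weyl: "weyl_connection M A g nabla \<theta> D"
    and preserves_T1: "preserves M A D T1" and preserves_T2: "preserves M A D T2"
    and distribution_T1: "distribution M A p T1"
    and orthogonal: "x \<in> topspace M \<Longrightarrow> u \<in> T1 x \<Longrightarrow> v \<in> T2 x \<Longrightarrow> g x u v = 0"
begin

lemma lee_form_linear: "x \<in> topspace M \<Longrightarrow> linear (\<theta> x)"
  using weyl by (simp add: weyl_connection_def one_form_def)

lemma lee_form_smooth: "openin M W \<Longrightarrow> smooth_field A W X \<Longrightarrow> smooth_fun A W (\<lambda>x. \<theta> x (X x))"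
  using weyl unfolding weyl_connection_def one_form_def by blast

lemma sharp_lee_form: "x \<in> topspace M \<Longrightarrow> g x (sharp g \<theta> x) w = \<theta> x w"
  using sharp_works[where \<theta> = \<theta>] lee_form_linear by blast

lemmas lee_form_simps = linear_add[OF lee_form_linear] linear_diff[OF lee_form_linear] linear_cmul[OF lee_form_linear]

lemma weyl_formula:
  assumes "openin M W" "x \<in> W" "smooth_field A W X" "smooth_field A W Y"
  shows "D X Y x = nabla X Y x + \<theta> x (Y x) *\<^sub>R X x + \<theta> x (X x) *\<^sub>R Y x
    - g x (X x) (Y x) *\<^sub>R sharp g \<theta> x"
proof -
  have "\<forall>W X Y. openin M W \<and> smooth_field A W X \<and> smooth_field A W Y \<longrightarrow>
      (\<forall>x\<in>W. D X Y x = nabla X Y x + \<theta> x (Y x) *\<^sub>R X x + \<theta> x (X x) *\<^sub>R Y x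
        - g x (X x) (Y x) *\<^sub>R sharp g \<theta> x)"
    using weyl by (simp add: weyl_connection_def)
  thus ?thesis using assms by blast
qed

lemma sectionD: "section_on A T W X \<Longrightarrow> smooth_field A W X" "section_on A T W X \<Longrightarrow> x \<in> W \<Longrightarrow> X x \<in> T x"
  by (auto simp: section_on_def)

lemma section_subset: "section_on A T W X \<Longrightarrow> V \<subseteq> W \<Longrightarrow> section_on A T V X"
  by (auto simp: section_on_def intro: smooth_field_subset)

lemma preserves_section:
  "preserves M A D T \<Longrightarrow> openin M W \<Longrightarrow> smooth_field A W X \<Longrightarrow> section_on A T W Y \<Longrightarrow> section_on A T W (D X Y)"
  unfolding preserves_def by blast

text \<open>\<open>D\<^sub>X E\<close> stays in \<open>T1\<close>, so only the term with \<open>\<theta>\<^sup>\<sharp>\<close> contributes to the component of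
  \<open>\<nabla>\<^sub>X E\<close> in \<open>T2\<close>: the leaves of \<open>T1\<close> are umbilic.\<close>

lemma second_fundamental_form:
  assumes W: "openin M W" "x \<in> W"
    and X: "section_on A T1 W X" and E: "section_on A T1 W E" and U: "section_on A T2 W U"
  shows "g x (nabla X E x) (U x) = g x (X x) (E x) * \<theta> x (U x)"
proof -
  have x: "x \<in> topspace M" by (rule in_topspace[OF W])
  have "g x (D X E x) (U x) = 0"
    using sectionD(2)[OF preserves_section[OF preserves_T1 W(1) sectionD(1)[OF X] E] W(2)]
      sectionD(2)[OF U W(2)] orthogonal[OF x] by blast
  moreover have "g x (X x) (U x) = 0" "g x (E x) (U x) = 0"
    using sectionD(2)[OF X W(2)] sectionD(2)[OF E W(2)] sectionD(2)[OF U W(2)] orthogonal[OF x] by blast+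
  ultimately show ?thesis
    unfolding weyl_formula[OF W sectionD(1)[OF X] sectionD(1)[OF E]]
    by (simp add: g_simps[OF x] sharp_lee_form[OF x])
qed

lemma T1_subspace: "x \<in> topspace M \<Longrightarrow> subspace (T1 x)"
  using distribution_T1 by (simp add: distribution_def)

text \<open>A Weyl connection is torsion-free, so a distribution that it preserves is integrable.\<close>

lemma bracket_section:
  assumes W: "openin M W" and X: "section_on A T1 W X" and Y: "section_on A T1 W Y"
  shows "section_on A T1 W (lie_bracket A X Y)"
  unfolding section_on_def
proof (intro conjI ballI)
  note s = sectionD(1)[OF X] sectionD(1)[OF Y]
  fix x assume x: "x \<in> W"
  have xM: "x \<in> topspace M" by (rule in_topspace[OF W x])
  have "D X Y x \<in> T1 x" "D Y X x \<in> T1 x"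
    using preserves_section[OF preserves_T1 W] X Y s sectionD(2)[OF _ x] by blast+
  moreover have "lie_bracket A X Y x = D X Y x - D Y X x"
    unfolding torsion_free[OF W x s] weyl_formula[OF W x s] weyl_formula[OF W x s(2,1)]
    by (simp add: g_sym[OF xM, of "Y x"])
  ultimately show "lie_bracket A X Y x \<in> T1 x" by (simp add: subspace_diff T1_subspace[OF xM])
next
  show "smooth_field A W (lie_bracket A X Y)"
    by (rule lie_bracket_smooth[OF W sectionD(1)[OF X] sectionD(1)[OF Y]])
qed

text \<open>The part of \<open>\<nabla>\<theta>\<close> that is visible in the mixed curvature; it is written \<open>P(X)\<close> in the comments.\<close>

abbreviation twisted_deriv :: "('a \<Rightarrow> real ^ 'n) \<Rightarrow> ('a \<Rightarrow> real ^ 'n) \<Rightarrow> 'a \<Rightarrow> real" where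
  "twisted_deriv X U x \<equiv> cov_deriv_form A nabla \<theta> X U x - \<theta> x (X x) * \<theta> x (U x)"

text \<open>Differentiate \<open>g(\<nabla>\<^sub>X E, U) = g(X, E) \<theta>(U)\<close> along \<open>Y\<close>.  The term \<open>g(\<nabla>\<^sub>X E, \<nabla>\<^sub>Y U)\<close> is computed by
  replacing \<open>\<nabla>\<^sub>Y U\<close> with \<open>D\<^sub>Y U\<close>, to which the same identity applies because it lies in \<open>T2\<close>.\<close>

lemma second_derivative_mixed:
  assumes W: "openin M W" "x \<in> W" and Y: "section_on A T1 W Y" and X: "section_on A T1 W X"
    and E: "section_on A T1 W E" and U: "section_on A T2 W U"
  shows "g x (nabla Y (nabla X E) x) (U x) =
    g x (X x) (E x) * twisted_deriv Y U x
    + \<theta> x (U x) * (g x (nabla Y X x) (E x) + g x (X x) (nabla Y E x) + g x (nabla X E x) (Y x))"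
proof -
  note s = sectionD(1)[OF X] sectionD(1)[OF Y] sectionD(1)[OF E] sectionD(1)[OF U]
  have x: "x \<in> topspace M" by (rule in_topspace[OF W])
  have YU: "g x (Y x) (U x) = 0"
    using sectionD(2)[OF Y W(2)] sectionD(2)[OF U W(2)] orthogonal[OF x] by blast
  have DYU: "section_on A T2 W (D Y U)" by (rule preserves_section[OF preserves_T2 W(1) s(2) U])
  have DYU': "D Y U x = nabla Y U x + \<theta> x (U x) *\<^sub>R Y x + \<theta> x (Y x) *\<^sub>R U x"
    using weyl_formula[OF W s(2,4)] YU by simp
  have "dir_deriv A Y (\<lambda>y. g y (nabla X E y) (U y)) x = dir_deriv A Y (\<lambda>y. g y (X y) (E y) * \<theta> y (U y)) x"
    by (intro dir_deriv_cong[OF W] second_fundamental_form[OF W(1)] X E U)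
  also have "\<dots> = g x (X x) (E x) * dir_deriv A Y (\<lambda>y. \<theta> y (U y)) x
      + dir_deriv A Y (\<lambda>y. g y (X y) (E y)) x * \<theta> x (U x)"
    by (intro dir_deriv_mult[OF W] g_smooth[OF W(1)] lee_form_smooth[OF W(1)] s)
  also have "dir_deriv A Y (\<lambda>y. g y (X y) (E y)) x = g x (nabla Y X x) (E x) + g x (X x) (nabla Y E x)"
    by (intro metric_compatible[OF W] s)
  also have "dir_deriv A Y (\<lambda>y. g y (nabla X E y) (U y)) x =
      g x (nabla Y (nabla X E) x) (U x) + g x (nabla X E x) (nabla Y U x)"
    by (intro metric_compatible[OF W] nabla_smooth[OF W(1)] s)
  finally have 1: "g x (nabla Y (nabla X E) x) (U x) + g x (nabla X E x) (nabla Y U x) =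
    g x (X x) (E x) * dir_deriv A Y (\<lambda>y. \<theta> y (U y)) x
    + (g x (nabla Y X x) (E x) + g x (X x) (nabla Y E x)) * \<theta> x (U x)" .
  have "g x (nabla X E x) (D Y U x) = g x (X x) (E x) * \<theta> x (D Y U x)"
    by (rule second_fundamental_form[OF W X E DYU])
  hence 2: "g x (nabla X E x) (nabla Y U x) = g x (X x) (E x) * (\<theta> x (nabla Y U x) + \<theta> x (Y x) * \<theta> x (U x))
    - \<theta> x (U x) * g x (nabla X E x) (Y x)"
    unfolding DYU' using second_fundamental_form[OF W X E U]
    by (simp add: g_simps[OF x] lee_form_simps[OF x] algebra_simps)
  show ?thesis using 1 2 by (simp add: cov_deriv_form_def algebra_simps)
qed

text \<open>Of the terms with the factor \<open>\<theta>(U)\<close>, two together are symmetric in \<open>X\<close> and \<open>Y\<close>; the third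
  antisymmetrizes to \<open>g([Y, X], E)\<close> and cancels the contribution of \<open>\<nabla>\<^bsub>[Y, X]\<^esub> E\<close>.\<close>

lemma curvature_mixed:
  assumes W: "openin M W" "x \<in> W" and Y: "section_on A T1 W Y" and X: "section_on A T1 W X"
    and E: "section_on A T1 W E" and U: "section_on A T2 W U"
  shows "g x (curvature A nabla Y X E x) (U x) = g x (X x) (E x) * twisted_deriv Y U x - g x (Y x) (E x) * twisted_deriv X U x"
proof -
  note s = sectionD(1)[OF X] sectionD(1)[OF Y] sectionD(1)[OF E] sectionD(1)[OF U]
  have x: "x \<in> topspace M" by (rule in_topspace[OF W])
  have "g x (nabla (lie_bracket A Y X) E x) (U x) = g x (lie_bracket A Y X x) (E x) * \<theta> x (U x)"
    by (rule second_fundamental_form[OF W bracket_section[OF W(1) Y X] E U])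
  thus ?thesis
    unfolding curvature_def g_simps[OF x] second_derivative_mixed[OF W Y X E U]
      second_derivative_mixed[OF W X Y E U] torsion_free[OF W s(2,1)]
    by (simp add: algebra_simps g_sym[OF x, of _ "nabla Y E x"] g_sym[OF x, of _ "nabla X E x"])
qed

text \<open>One neighbourhood serves all vectors at \<open>x\<close>: extend by constant combinations of a local frame.\<close>

lemma section_extension:
  assumes x: "x \<in> topspace M"
  obtains W where "openin M W" "x \<in> W" "\<And>v. v \<in> T1 x \<Longrightarrow> \<exists>E. section_on A T1 W E \<and> E x = v"
proof -
  have "\<exists>W. openin M W \<and> x \<in> W \<and> (\<exists>F :: nat \<Rightarrow> 'a \<Rightarrow> real ^ 'n.
      (\<forall>i<p. smooth_field A W (F i)) \<and> (\<forall>y\<in>W. T1 y = span {F i y | i. i < p}))"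
    using distribution_T1 x by (simp add: distribution_def)
  then obtain W and F :: "nat \<Rightarrow> 'a \<Rightarrow> real ^ 'n" where W: "openin M W" "x \<in> W"
    and F: "\<And>i. i < p \<Longrightarrow> smooth_field A W (F i)" "\<And>y. y \<in> W \<Longrightarrow> T1 y = span {F i y | i. i < p}"
    by (elim exE conjE) blast
  define Q where "Q v \<longleftrightarrow> (\<exists>E. section_on A T1 W E \<and> E x = v)" for v
  have sub: "subspace (T1 y)" if "y \<in> W" for y
    using in_topspace[OF W(1) that] by (rule T1_subspace)
  have "Q v" if "v \<in> T1 x" for v
  proof (rule span_induct[of v "{F i x | i. i < p}" Q])
    show "v \<in> span {F i x | i. i < p}" using that F(2)[OF W(2)] by simp
    show "Q w" if w: "w \<in> {F i x | i. i < p}" for w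
    proof -
      obtain i where i: "i < p" "w = F i x" using w by blast
      have "F i y \<in> T1 y" if "y \<in> W" for y
        unfolding F(2)[OF that] using i by (intro span_base) blast
      hence "section_on A T1 W (F i)" using F(1)[OF i(1)] by (simp add: section_on_def)
      thus ?thesis using i by (auto simp: Q_def)
    qed
    have "Q 0"
      unfolding Q_def using smooth_field_zero[OF W(1)] subspace_0[OF sub]
      by (intro exI[of _ "\<lambda>y. 0"]) (simp add: section_on_def)
    moreover have "Q (v + w)" if vw: "Q v" "Q w" for v w
    proof -
      obtain E E' where "section_on A T1 W E" "E x = v" "section_on A T1 W E'" "E' x = w"
        using vw unfolding Q_def by blast
      thus ?thesis unfolding Q_def
        using smooth_field_add[OF W(1)] subspace_add[OF sub]
        by (intro exI[of _ "\<lambda>y. E y + E' y"]) (simp add: section_on_def)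
    qed
    moreover have "Q (k *\<^sub>R v)" if v: "Q v" for k v
    proof -
      obtain E where "section_on A T1 W E" "E x = v"
        using v unfolding Q_def by blast
      thus ?thesis unfolding Q_def
        using smooth_field_scale[OF W(1) smooth_fun_const] subspace_scale[OF sub]
        by (intro exI[of _ "\<lambda>y. k *\<^sub>R E y"]) (simp add: section_on_def)
    qed
    ultimately show "subspace (Collect Q)" by (simp add: subspace_def)
  qed
  thus ?thesis using that[OF W] unfolding Q_def by blast
qed

lemma cov_deriv_form_sum:
  assumes W: "openin M W" "x \<in> W" and X: "smooth_field A W X" and U: "smooth_field A W U"
    and I: "finite I" "\<And>i. i \<in> I \<Longrightarrow> smooth_field A W (E i)"
    and eq: "X x = (\<Sum>i\<in>I. k i *\<^sub>R E i x)"
  shows "cov_deriv_form A nabla \<theta> X U x = (\<Sum>i\<in>I. k i * cov_deriv_form A nabla \<theta> (E i) U x)"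
proof -
  have x: "x \<in> topspace M" by (rule in_topspace[OF W])
  have c: "chart_at A x \<in> A" "x \<in> fst (chart_at A x)" using chart_at[OF x] by auto
  have L: "linear (fder ((\<lambda>y. \<theta> y (U y)) \<circ> chart_inv (chart_at A x)) (snd (chart_at A x) x))"
    by (rule fder_linear[OF smooth_fun_differentiable[OF W(1) lee_form_smooth[OF W(1) U] W(2) c]])
  have "nabla X U x = nabla (\<lambda>y. \<Sum>i\<in>I. k i *\<^sub>R E i y) U x"
    using eq by (intro nabla_point_left[OF W X _ _ U] smooth_field_sum[OF W(1)]
        smooth_field_scale[OF W(1) smooth_fun_const] I(2))
  also have "\<dots> = (\<Sum>i\<in>I. k i *\<^sub>R nabla (E i) U x)"
    using nabla_sum_left[where f = "\<lambda>i y. k i" and E = E, OF W I(1) smooth_fun_const I(2) U] by simp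
  finally show ?thesis
    unfolding cov_deriv_form_def dir_deriv_def eq
    by (simp add: linear_sum[OF L] linear_cmul[OF L] linear_sum[OF lee_form_linear[OF x]] linear_cmul[OF lee_form_linear[OF x]]
        sum_subtractf right_diff_distrib)
qed

text \<open>The first term of \<open>g(R(X, e)e, U) = P(X) - g(X, e) P(e)\<close> contributes \<open>P(X)\<close> for each of the \<open>p\<close>
  basis vectors, the second one sums to \<open>P(X)\<close> by linearity.\<close>

lemma partial_ricci:
  assumes W: "openin M W" "x \<in> W" and X: "section_on A T1 W X" and U: "section_on A T2 W U"
    and B: "orthonormal_at x B" "span B = T1 x"
  shows "(\<Sum>b\<in>B. g x (curvature_at M A nabla x (X x) b b) (U x)) = (real p - 1) * twisted_deriv X U x"
proof -
  have x: "x \<in> topspace M" by (rule in_topspace[OF W])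
  interpret inner_form "g x" by (rule g_inner_form[OF x])
  obtain V where V: "openin M V" "x \<in> V" "\<And>v. v \<in> T1 x \<Longrightarrow> \<exists>E. section_on A T1 V E \<and> E x = v"
    by (rule section_extension[OF x]) (rule that)
  have "\<forall>b\<in>B. \<exists>E. section_on A T1 V E \<and> E x = b" using V(3) B(2) span_base by blast
  then obtain E where E: "\<And>b. b \<in> B \<Longrightarrow> section_on A T1 V (E b)" "\<And>b. b \<in> B \<Longrightarrow> E b x = b"
    by metis
  have o: "openin M (W \<inter> V)" "x \<in> W \<inter> V" using W V by auto
  have s: "section_on A T1 (W \<inter> V) X" "section_on A T2 (W \<inter> V) U" "\<And>b. b \<in> B \<Longrightarrow> section_on A T1 (W \<inter> V) (E b)"
    using X U E(1) section_subset by blast+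
  have Xx: "X x = (\<Sum>b\<in>B. g x (X x) b *\<^sub>R b)"
    by (rule orthonormal_expansion[OF B(1)]) (simp add: B(2) sectionD(2)[OF X W(2)])
  have card: "card B = p"
    using dim_span_eq_card_independent[OF orthonormal_independent[OF B(1)]] B(2) distribution_T1 x
    by (simp add: distribution_def)
  have 1: "g x (curvature_at M A nabla x (X x) b b) (U x) = twisted_deriv X U x - g x (X x) b * twisted_deriv (E b) U x" if b: "b \<in> B" for b
  proof -
    have "curvature_at M A nabla x (X x) b b = curvature A nabla X (E b) (E b) x"
      by (rule curvature_at_eq[OF o]) (use s b E in \<open>auto intro: sectionD\<close>)
    thus ?thesis
      using curvature_mixed[OF o s(1) s(3)[OF b] s(3)[OF b] s(2)] E(2)[OF b] b B(1)
      by (simp add: orthonormal_def)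
  qed
  have "cov_deriv_form A nabla \<theta> X U x = (\<Sum>b\<in>B. g x (X x) b * cov_deriv_form A nabla \<theta> (E b) U x)"
    by (rule cov_deriv_form_sum[OF o]) (use s E(2) orthonormal_finite[OF B(1)] Xx in \<open>auto intro: sectionD\<close>)
  moreover have "\<theta> x (X x) = (\<Sum>b\<in>B. g x (X x) b * \<theta> x (E b x))"
    by (subst Xx) (simp add: linear_sum[OF lee_form_linear[OF x]] linear_cmul[OF lee_form_linear[OF x]] E(2))
  ultimately have "(\<Sum>b\<in>B. g x (X x) b * twisted_deriv (E b) U x) = twisted_deriv X U x"
    by (simp add: right_diff_distrib sum_subtractf sum_distrib_right mult.assoc)
  thus ?thesis by (simp add: 1 sum_subtractf card left_diff_distrib)
qed

end

context riemannian
begin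

lemma exterior_deriv_cov_deriv_form:
  assumes W: "openin M W" "x \<in> W" and X: "smooth_field A W X" "smooth_field A W U"
    and L: "linear (\<theta> x)"
  shows "exterior_deriv A \<theta> X U x = cov_deriv_form A nabla \<theta> X U x - cov_deriv_form A nabla \<theta> U X x"
  by (simp add: exterior_deriv_def cov_deriv_form_def torsion_free[OF W X] linear_diff[OF L])

text \<open>On the part of the basis in \<open>T2\<close> the pair symmetry exchanges the roles of \<open>X\<close> and \<open>U\<close>, and of the
  two distributions with them.\<close>

lemma conformal_product_ricci:
  assumes cp: "conformal_product M A g nabla p q T1 T2 \<theta> D"
    and W: "openin M W" "x \<in> W" and X: "section_on A T1 W X" and U: "section_on A T2 W U"
  shows "ricci M A g nabla x (X x) (U x) =
    (real p - 1) * (cov_deriv_form A nabla \<theta> X U x - \<theta> x (X x) * \<theta> x (U x))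
    + (real q - 1) * (cov_deriv_form A nabla \<theta> U X x - \<theta> x (X x) * \<theta> x (U x))"
proof -
  have x: "x \<in> topspace M" by (rule in_topspace[OF W])
  interpret inner_form "g x" by (rule g_inner_form[OF x])
  have split: "orthogonal_splitting M A g p q T1 T2" using cp by (simp add: conformal_product_def)
  have orth: "g x u v = 0" "g x v u = 0" if "x \<in> topspace M" "u \<in> T1 x" "v \<in> T2 x" for x u v
    using split that g_sym[OF that(1), of v u] by (auto simp: orthogonal_splitting_def)
  interpret one: adapted_weyl M A g nabla T1 T2 \<theta> D p
    using cp orth by unfold_locales (auto simp: conformal_product_def orthogonal_splitting_def)
  interpret two: adapted_weyl M A g nabla T2 T1 \<theta> D q
    using cp orth by unfold_locales (auto simp: conformal_product_def orthogonal_splitting_def)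
  obtain B where B: "orthonormal B" "B \<subseteq> T1 x" "span B = T1 x"
    by (rule orthonormal_basis_exists[OF one.T1_subspace[OF x]])
  obtain C where C: "orthonormal C" "C \<subseteq> T2 x" "span C = T2 x"
    by (rule orthonormal_basis_exists[OF two.T1_subspace[OF x]])
  have bc: "g x b c = 0" "g x c b = 0" "b \<noteq> c" if "b \<in> B" "c \<in> C" for b c
  proof -
    show bc: "g x b c = 0" using one.orthogonal[OF x] that B(2) C(2) by blast
    thus "g x c b = 0" by (simp add: g_sym[OF x])
    show "b \<noteq> c" using bc B(1) that(1) by (auto simp: orthonormal_def)
  qed
  have BC: "orthonormal (B \<union> C)"
    using B(1) C(1) bc unfolding orthonormal_def by (auto; metis)
  have span: "span (B \<union> C) = UNIV"
  proof -
    have "\<exists>u\<in>T1 x. \<exists>v\<in>T2 x. w = u + v" for w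
      using split x by (simp add: orthogonal_splitting_def)
    thus ?thesis unfolding span_Un B(3) C(3) by blast
  qed
  have C_sum: "(\<Sum>c\<in>C. g x (curvature_at M A nabla x (X x) c c) (U x)) =
      (\<Sum>c\<in>C. g x (curvature_at M A nabla x (U x) c c) (X x))"
  proof (rule sum.cong[OF refl])
    fix c
    have "g x (curvature_at M A nabla x (X x) c c) (U x) = g x (curvature_at M A nabla x c (U x) (X x)) c"
      by (rule R_pair_symmetry[OF x])
    also have "\<dots> = - g x (curvature_at M A nabla x (U x) c (X x)) c"
      using R_swap[OF x, of c "U x" "X x"] by (simp add: g_simps[OF x])
    also have "\<dots> = g x (X x) (curvature_at M A nabla x (U x) c c)"
      using R_metric[OF x, of "U x" c "X x" c] by simp
    finally show "g x (curvature_at M A nabla x (X x) c c) (U x) = g x (curvature_at M A nabla x (U x) c c) (X x)"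
      by (simp add: g_sym[OF x])
  qed
  have "ricci M A g nabla x (X x) (U x) = (\<Sum>b\<in>B \<union> C. g x (curvature_at M A nabla x (X x) b b) (U x))"
    by (rule ricci_eq[OF x BC span])
  also have "\<dots> = (\<Sum>b\<in>B. g x (curvature_at M A nabla x (X x) b b) (U x))
      + (\<Sum>c\<in>C. g x (curvature_at M A nabla x (U x) c c) (X x))"
    unfolding C_sum[symmetric]
    by (rule sum.union_disjoint) (use bc(3) orthonormal_finite B(1) C(1) in auto)
  also have "\<dots> = (real p - 1) * (cov_deriv_form A nabla \<theta> X U x - \<theta> x (X x) * \<theta> x (U x))
    + (real q - 1) * (cov_deriv_form A nabla \<theta> U X x - \<theta> x (U x) * \<theta> x (X x))"
    by (simp only: one.partial_ricci[OF W X U B(1,3)] two.partial_ricci[OF W U X C(1,3)])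
  finally show ?thesis by (simp add: mult.commute)
qed

end

theorem corollary2p7:
  fixes M :: "'a topology" and A :: "('a, 'n::finite) chart set"
    and g :: "'a \<Rightarrow> real ^ 'n \<Rightarrow> real ^ 'n \<Rightarrow> real"
    and nabla D :: "('a, 'n) conn"
    and T1 T2 :: "'a \<Rightarrow> (real ^ 'n) set"
    and \<theta> \<theta>1 \<theta>2 :: "'a \<Rightarrow> real ^ 'n \<Rightarrow> real"
    and n p q :: nat
  assumes "smooth_manifold M A" and "CARD('n) = n"
    and "riemannian_metric M A g"
    and "levi_civita M A g nabla"
    and "conformal_product M A g nabla p q T1 T2 \<theta> D"
    and "p \<ge> 2" and "q \<ge> 2" and "n = p + q"
    and "form_splitting M T1 T2 \<theta> \<theta>1 \<theta>2"
  shows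
    "(\<forall>W X U. openin M W \<and> section_on A T1 W X \<and> section_on A T2 W U \<longrightarrow> (\<forall>x\<in>W.
        cov_deriv_form A nabla \<theta> X U x =
          \<theta>1 x (X x) * \<theta>2 x (U x)
          + (real q - 1) / (real n - 2) * exterior_deriv A \<theta> X U x
          + 1 / (real n - 2) * ricci M A g nabla x (X x) (U x) \<and>
        cov_deriv_form A nabla \<theta> U X x =
          \<theta>1 x (X x) * \<theta>2 x (U x)
          - (real p - 1) / (real n - 2) * exterior_deriv A \<theta> X U x
          + 1 / (real n - 2) * ricci M A g nabla x (X x) (U x)))
     \<and>
     ((\<forall>x\<in>topspace M. \<forall>u\<in>T1 x. \<forall>v\<in>T2 x. ricci M A g nabla x u v = 0) \<longrightarrow>
      (\<forall>W X U. openin M W \<and> section_on A T1 W X \<and> section_on A T2 W U \<longrightarrow> (\<forall>x\<in>W.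
        cov_deriv_form A nabla \<theta> X U x =
          \<theta>1 x (X x) * \<theta>2 x (U x)
          + (real q - 1) / (real n - 2) * exterior_deriv A \<theta> X U x \<and>
        cov_deriv_form A nabla \<theta> U X x =
          \<theta>1 x (X x) * \<theta>2 x (U x)
          - (real p - 1) / (real n - 2) * exterior_deriv A \<theta> X U x)))"
proof -
  interpret riemannian M A g nabla
    using assms(1,3,4) by unfold_locales
  have main: "cov_deriv_form A nabla \<theta> X U x =
        \<theta>1 x (X x) * \<theta>2 x (U x)
        + (real q - 1) / (real n - 2) * exterior_deriv A \<theta> X U x
        + 1 / (real n - 2) * ricci M A g nabla x (X x) (U x)"
      "cov_deriv_form A nabla \<theta> U X x =
        \<theta>1 x (X x) * \<theta>2 x (U x)
        - (real p - 1) / (real n - 2) * exterior_deriv A \<theta> X U x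
        + 1 / (real n - 2) * ricci M A g nabla x (X x) (U x)"
    if W: "openin M W" "x \<in> W" and X: "section_on A T1 W X" and U: "section_on A T2 W U" for W X U x
  proof -
    have x: "x \<in> topspace M" by (rule in_topspace[OF W])
    have XU: "smooth_field A W X" "smooth_field A W U" "X x \<in> T1 x" "U x \<in> T2 x"
      using X U W by (auto simp: section_on_def)
    have L: "linear (\<theta> x)"
      using assms(5) x by (simp add: conformal_product_def weyl_connection_def one_form_def)
    have \<theta>: "\<theta> x (X x) = \<theta>1 x (X x)" "\<theta> x (U x) = \<theta>2 x (U x)"
      using assms(9) x XU(3,4) by (auto simp: form_splitting_def)
    define a b where "a = cov_deriv_form A nabla \<theta> X U x - \<theta>1 x (X x) * \<theta>2 x (U x)"
      and "b = cov_deriv_form A nabla \<theta> U X x - \<theta>1 x (X x) * \<theta>2 x (U x)"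
    have d: "exterior_deriv A \<theta> X U x = a - b"
      using exterior_deriv_cov_deriv_form[OF W XU(1,2), of \<theta>] L by (simp add: a_def b_def)
    have ric: "ricci M A g nabla x (X x) (U x) = (real p - 1) * a + (real q - 1) * b"
      using conformal_product_ricci[OF assms(5) W X U] by (simp add: \<theta> a_def b_def)
    define m where "m = real n - 2"
    have m: "m > 0" "m = (real p - 1) + (real q - 1)" using assms(6-8) by (auto simp: m_def)
    have quot: "z = u / m * v + 1 / m * r" if "z * m = u * v + r" for z u v r :: real
      using that m(1) by (simp add: field_simps)
    have quot': "z = - (u / m * v) + 1 / m * r" if "z * m = - (u * v) + r" for z u v r :: real
      using that m(1) by (simp add: field_simps)
    have "a * m = (real q - 1) * (a - b) + ((real p - 1) * a + (real q - 1) * b)"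
      "b * m = - ((real p - 1) * (a - b)) + ((real p - 1) * a + (real q - 1) * b)"
      unfolding m(2) by (simp_all add: algebra_simps)
    hence "a = (real q - 1) / m * (a - b) + 1 / m * ((real p - 1) * a + (real q - 1) * b)"
      "b = - ((real p - 1) / m * (a - b)) + 1 / m * ((real p - 1) * a + (real q - 1) * b)"
      by (blast intro: quot quot')+
    thus "cov_deriv_form A nabla \<theta> X U x =
        \<theta>1 x (X x) * \<theta>2 x (U x)
        + (real q - 1) / (real n - 2) * exterior_deriv A \<theta> X U x
        + 1 / (real n - 2) * ricci M A g nabla x (X x) (U x)"
      "cov_deriv_form A nabla \<theta> U X x =
        \<theta>1 x (X x) * \<theta>2 x (U x)
        - (real p - 1) / (real n - 2) * exterior_deriv A \<theta> X U x
        + 1 / (real n - 2) * ricci M A g nabla x (X x) (U x)"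
      unfolding d ric m_def[symmetric] by (simp_all add: a_def b_def)
  qed
  show ?thesis
  proof (intro conjI impI allI ballI)
    fix W X U x
    assume "\<forall>x\<in>topspace M. \<forall>u\<in>T1 x. \<forall>v\<in>T2 x. ricci M A g nabla x u v = 0"
      and s: "openin M W \<and> section_on A T1 W X \<and> section_on A T2 W U" and x: "x \<in> W"
    hence ric: "ricci M A g nabla x (X x) (U x) = 0"
      using in_topspace[of W x] by (auto simp: section_on_def)
    show "cov_deriv_form A nabla \<theta> X U x =
        \<theta>1 x (X x) * \<theta>2 x (U x) + (real q - 1) / (real n - 2) * exterior_deriv A \<theta> X U x"
      "cov_deriv_form A nabla \<theta> U X x =
        \<theta>1 x (X x) * \<theta>2 x (U x) - (real p - 1) / (real n - 2) * exterior_deriv A \<theta> X U x"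
      using main[of W x X U] s x ric by auto
  qed (use main in blast)+
qed

end
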